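(* Let $V=V_0\oplus V_1$ be a $\mathbb{Z}_2$-graded complex vector space with $\dim V_0=\dim V_1=k\ge 1$, let $n\ge 2$, and consider the sign permutation action $\varphi^*$ of $S_n$ on $V^{\otimes n}$. Let $\mathcal{B}_n=\mathrm{End}_{\mathbb{C}S_n}(V^{\otimes n})$ and $\mathcal{A}_n=\mathrm{End}_{\mathbb{C}A_n}(V^{\otimes n})$. Then there is a subgroup $H$ of the group of algebra automorphisms of $\mathcal{B}_n$ with $H\cong\mathbb{Z}_2$ such that the algebra $\mathcal{A}_n$ is isomorphic to the crossed product $\mathcal{B}_n\times\mathbb{C}H$. In particular $\dim\mathcal{A}_n=2\dim\mathcal{B}_n$.
   Context: Elements of $V_0$ have degree $0$ and nonzero elements of $V_1$ have degree $1$. The sign permutation action: for $\sigma\in S_n$ and homogeneous $v_1,\dots,v_n\in V$, $\varphi^*_\sigma(v_1\otimes\cdots\otimes v_n)=\epsilon\, v_{\sigma^{-1}(1)}\otimes\cdots\otimes v_{\sigma^{-1}(n)}$ with $\epsilon=\prod_{i<j,\ \sigma(i)>\sigma(j)}(-1)^{\deg v_i\deg v_j}$ (e.g. $\varphi^*_{(1,2)}(y_1\otimes y_2)=(-1)^{\deg y_1\deg y_2}y_2\otimes y_1$), extended linearly; it gives an algebra homomorphism $\varphi^*:\mathbb{C}S_n\to\mathrm{End}_{\mathbb{C}}(V^{\otimes n})$. $A_n\subseteq S_n$ is the alternating group; $\mathcal{B}_n$ (resp. $\mathcal{A}_n$) is the algebra of linear maps on $V^{\otimes n}$ commuting with all $\varphi^*_\sigma$,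 $\sigma\in S_n$ (resp. $\sigma\in A_n$). For a finite group $G$ of automorphisms of an algebra $R$, the crossed product $R\times\mathbb{C}G$ is the vector space $R\otimes_{\mathbb{C}}\mathbb{C}G$ with multiplication $(r_1\otimes g_1)(r_2\otimes g_2)=r_1\,g_1(r_2)\otimes g_1g_2$. *)

theory Defs
  imports Complex_Main "HOL-Library.Function_Algebras"
    "HOL-Algebra.Sym_Groups" "HOL-Algebra.Elementary_Groups" "HOL-Algebra.Bij"
    "HOL-Algebra.QuotRing" "HOL-Algebra.Module"
begin

section \<open>Graded spaces and tensor powers\<close>

text \<open>Vector spaces are given, as in \<^theory>\<open>HOL.Vector_Spaces\<close>, by a scalar multiplication
  on an additive group type.\<close>

definition z2_graded ::
  "(complex \<Rightarrow> 'v \<Rightarrow> 'v) \<Rightarrow> 'v::ab_group_add set \<Rightarrow> 'v set \<Rightarrow> bool" where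
  "z2_graded s V0 V1 \<longleftrightarrow> vector_space s \<and> module.subspace s V0 \<and> module.subspace s V1 \<and>
     V0 \<inter> V1 = {0} \<and> (\<forall>x. \<exists>a\<in>V0. \<exists>b\<in>V1. x = a + b)"

text \<open>An \<open>n\<close>-tuple is a function on indices of which only the values on \<open>{1..n}\<close> matter.\<close>

definition multilinear ::
  "nat \<Rightarrow> (complex \<Rightarrow> 'v::ab_group_add \<Rightarrow> 'v) \<Rightarrow> (complex \<Rightarrow> 'w::ab_group_add \<Rightarrow> 'w)
    \<Rightarrow> ((nat \<Rightarrow> 'v) \<Rightarrow> 'w) \<Rightarrow> bool" where
  "multilinear n sV sW f \<longleftrightarrow>
     (\<forall>v w. (\<forall>i\<in>{1..n}. v i = w i) \<longrightarrow> f v = f w) \<and>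
     (\<forall>v. \<forall>i\<in>{1..n}. Vector_Spaces.linear sV sW (\<lambda>x. f (v(i := x))))"

text \<open>\<open>tensor_power n sV sT tens\<close>: the vector space \<open>sT\<close> together with
  \<open>tens v = v\<^sub>1 \<otimes> \<dots> \<otimes> v\<^sub>n\<close> is the \<open>n\<close>-th tensor power of \<open>sV\<close>.  A definition cannot quantify over
  all target types, so the universal property is required here for scalar-valued forms only;
  \<open>tensor_power_universal\<close> below derives it for an arbitrary target space, and
  \<open>tensor_power_exists\<close> shows that tensor powers exist.\<close>

definition tensor_power ::
  "nat \<Rightarrow> (complex \<Rightarrow> 'v::ab_group_add \<Rightarrow> 'v) \<Rightarrow> (complex \<Rightarrow> 't::ab_group_add \<Rightarrow> 't)
    \<Rightarrow> ((nat \<Rightarrow> 'v) \<Rightarrow> 't) \<Rightarrow> bool" where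
  "tensor_power n sV sT tens \<longleftrightarrow>
     vector_space sV \<and> vector_space sT \<and> multilinear n sV sT tens \<and>
     (\<forall>f. multilinear n sV (*) f \<longrightarrow>
        (\<exists>!g. Vector_Spaces.linear sT (*) g \<and> (\<forall>v. g (tens v) = f v)))"

lemma multilinearD:
  assumes "multilinear n sV sW f" and "i \<in> {1..n}"
  shows "Vector_Spaces.linear sV sW (\<lambda>x. f (v(i := x)))"
  using assms unfolding multilinear_def by blast

lemma multilinear_compose:
  assumes "multilinear n sV sW f" "Vector_Spaces.linear sW sU g"
  shows "multilinear n sV sU (\<lambda>v. g (f v))"
  unfolding multilinear_def
proof (intro conjI allI impI ballI)
  show "g (f v) = g (f w)" if "\<forall>i\<in>{1..n}. v i = w i" for v w
  proof -
    have "f v = f w" using assms(1) that unfolding multilinear_def by blast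
    then show ?thesis by simp
  qed
  show "Vector_Spaces.linear sV sU (\<lambda>x. g (f (v(i := x))))" if "i \<in> {1..n}" for v i
    using Vector_Spaces.linear_compose[OF multilinearD[OF assms(1) that] assms(2)]
    by (simp add: o_def)
qed

lemma vector_space_complex: "vector_space ((*) :: complex \<Rightarrow> complex \<Rightarrow> complex)"
  by unfold_locales (auto simp: algebra_simps)

lemma functional_exists:
  fixes s :: "complex \<Rightarrow> 'a::ab_group_add \<Rightarrow> 'a"
  assumes "vector_space s" "x \<notin> module.span s S"
  shows "\<exists>g. Vector_Spaces.linear s (*) g \<and> g x = (1::complex) \<and> (\<forall>y\<in>S. g y = 0)"
proof -
  interpret vector_space s by fact
  interpret C: vector_space "(*) :: complex \<Rightarrow> complex \<Rightarrow> complex" by (rule vector_space_complex)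
  interpret VC: vector_space_pair s "(*) :: complex \<Rightarrow> complex \<Rightarrow> complex" ..
  obtain B where B: "B \<subseteq> S" "independent B" "S \<subseteq> span B"
    using maximal_independent_subset by blast
  have x: "x \<notin> span B" using assms(2) B span_mono by blast
  then have ind: "independent (insert x B)" using B independent_insertI by blast
  obtain g where g: "Vector_Spaces.linear s (*) g"
      "\<forall>y\<in>insert x B. g y = (if y = x then (1::complex) else 0)"
    using VC.linear_independent_extend[OF ind, of "\<lambda>y. if y = x then 1 else 0"] by blast
  have "g y = 0" if "y \<in> S" for y
  proof -
    interpret g: Vector_Spaces.linear s "(*)" g by fact
    have "y \<in> span B" using that B by blast
    then show ?thesis
      by (rule g.eq_0_on_span[rotated]) (use g(2) x span_base in auto)
  qed
  then show ?thesis using g by auto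
qed

lemma tensor_power_span:
  assumes "tensor_power n sV sT tens"
  shows "module.span sT (range tens) = UNIV"
proof (rule ccontr)
  assume "module.span sT (range tens) \<noteq> UNIV"
  then obtain x where x: "x \<notin> module.span sT (range tens)" by blast
  have vs: "vector_space sT" using assms by (simp add: tensor_power_def)
  interpret vector_space sT by fact
  interpret C: vector_space "(*) :: complex \<Rightarrow> complex \<Rightarrow> complex" by (rule vector_space_complex)
  interpret VC: vector_space_pair sT "(*) :: complex \<Rightarrow> complex \<Rightarrow> complex" ..
  obtain g where g: "Vector_Spaces.linear sT (*) g" "g x = (1::complex)"
      "\<forall>y\<in>range tens. g y = 0"
    using functional_exists[OF vs x] by blast
  have l0: "Vector_Spaces.linear sT (*) (\<lambda>_. 0 :: complex)" by (rule VC.linear_zero)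
  have "multilinear n sV (*) (\<lambda>v. (\<lambda>_. 0 :: complex) (tens v))"
    using assms l0 multilinear_compose unfolding tensor_power_def by blast
  then have "\<exists>!h. Vector_Spaces.linear sT (*) h \<and> (\<forall>v. h (tens v) = (0::complex))"
    using assms unfolding tensor_power_def by simp
  then have "g = (\<lambda>_. 0)" using g l0 by blast
  then show False using g(2) by simp
qed

theorem tensor_power_universal:
  assumes T: "tensor_power n sV sT tens" and U: "vector_space sU"
    and f: "multilinear n sV sU f"
  shows "\<exists>!g. Vector_Spaces.linear sT sU g \<and> (\<forall>v. g (tens v) = f v)"
proof -
  have vs: "vector_space sV" "vector_space sT" and m: "multilinear n sV sT tens"
    using T by (auto simp: tensor_power_def)
  interpret V: vector_space sV by fact
  interpret T: vector_space sT by fact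
  interpret U: vector_space sU by fact
  interpret TU: vector_space_pair sT sU ..
  interpret C: vector_space "(*) :: complex \<Rightarrow> complex \<Rightarrow> complex" by (rule vector_space_complex)
  interpret TC: vector_space_pair sT "(*) :: complex \<Rightarrow> complex \<Rightarrow> complex" ..
  obtain B where B: "B \<subseteq> range tens" "T.independent B" "range tens \<subseteq> T.span B"
    using T.maximal_independent_subset by blast
  have spB: "T.span B = UNIV"
    using T.span_mono[OF B(3)] tensor_power_span[OF T] by (simp add: T.span_span top.extremum_unique)
  obtain r where r: "\<And>b. b \<in> B \<Longrightarrow> tens (r b) = b"
    using B(1) by (metis f_inv_into_f subsetD)
  obtain g where g: "Vector_Spaces.linear sT sU g" "\<forall>b\<in>B. g b = f (r b)"
    using TU.linear_independent_extend[OF B(2), of "\<lambda>b. f (r b)"] by blast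
  have eq: "g (tens v) = f v" for v
  proof (rule ccontr)
    define d where "d w = g (tens w) - f w" for w
    assume "g (tens v) \<noteq> f v"
    then have "d v \<notin> U.span {}" by (simp add: d_def)
    then obtain l where l: "Vector_Spaces.linear sU (*) l" "l (d v) = (1::complex)"
      using functional_exists[OF U] by blast
    interpret l: Vector_Spaces.linear sU "(*)" l by fact
    have "multilinear n sV (*) (\<lambda>w. l (f w))" using multilinear_compose[OF f l(1)] .
    then obtain h where h: "Vector_Spaces.linear sT (*) h" "\<And>w. h (tens w) = l (f w)"
      using T unfolding tensor_power_def by blast
    have lg: "Vector_Spaces.linear sT (*) (\<lambda>x. l (g x))"
      using Vector_Spaces.linear_compose[OF g(1) l(1)] by (simp add: o_def)
    have "l (g (tens v)) = h (tens v)"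
    proof (rule TC.linear_eq_on[OF lg h(1)])
      show "tens v \<in> T.span B" by (simp add: spB)
      show "l (g b) = h b" if "b \<in> B" for b using that g(2) h(2)[of "r b"] r by simp
    qed
    then have "l (d v) = 0" using h(2)[of v] by (simp add: d_def l.diff)
    then show False using l(2) by simp
  qed
  show ?thesis
  proof (rule ex1I[of _ g])
    show "Vector_Spaces.linear sT sU g \<and> (\<forall>v. g (tens v) = f v)" using g eq by blast
    fix g' assume g': "Vector_Spaces.linear sT sU g' \<and> (\<forall>v. g' (tens v) = f v)"
    show "g' = g"
    proof
      fix x show "g' x = g x"
        by (rule TU.linear_eq_on[of g' g x "range tens"])
          (use g' g eq tensor_power_span[OF T] in auto)
    qed
  qed
qed

lemma multilinear_eq_on_spanning:
  assumes V: "vector_space sV" and U: "vector_space sU" and S: "module.span sV S = UNIV"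
    and f: "multilinear n sV sU f" and g: "multilinear n sV sU g"
    and eq: "\<And>v. (\<forall>i\<in>{1..n}. v i \<in> S) \<Longrightarrow> f v = g v"
  shows "f v = g v"
proof -
  interpret V: vector_space sV by fact
  interpret U: vector_space sU by fact
  interpret VU: vector_space_pair sV sU ..
  have "\<forall>v. (\<forall>i\<in>{1..n}. m < i \<longrightarrow> v i \<in> S) \<longrightarrow> f v = g v" if "m \<le> n" for m
    using that
  proof (induction m)
    case 0
    then show ?case using eq by auto
  next
    case (Suc m)
    show ?case
    proof (intro allI impI)
      fix v :: "nat \<Rightarrow> 'a" assume v: "\<forall>i\<in>{1..n}. Suc m < i \<longrightarrow> v i \<in> S"
      have i: "Suc m \<in> {1..n}" using Suc by auto
      have "f (v(Suc m := v (Suc m))) = g (v(Suc m := v (Suc m)))"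
      proof (rule VU.linear_eq_on[OF multilinearD[OF f i] multilinearD[OF g i]])
        show "v (Suc m) \<in> V.span S" using S by simp
        show "f (v(Suc m := x)) = g (v(Suc m := x))" if "x \<in> S" for x
        proof -
          have "\<forall>i\<in>{1..n}. m < i \<longrightarrow> (v(Suc m := x)) i \<in> S" using v that by auto
          then show ?thesis using Suc by simp
        qed
      qed
      then show "f v = g v" by simp
    qed
  qed
  from this[of n] show ?thesis by simp
qed

theorem tensor_power_exists:
  fixes sV :: "complex \<Rightarrow> 'v::ab_group_add \<Rightarrow> 'v" and sT :: "complex \<Rightarrow> 't::ab_group_add \<Rightarrow> 't"
  assumes V: "vector_space sV" and B: "finite B" "module.independent sV B" "module.span sV B = UNIV"
    and T: "vector_space sT" and C: "finite C" "module.independent sT C" "module.span sT C = UNIV"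
    and card: "card C = card B ^ n"
  shows "\<exists>tens. tensor_power n sV sT tens"
proof -
  interpret V: vector_space sV by fact
  interpret T: vector_space sT by fact
  interpret C: vector_space "(*) :: complex \<Rightarrow> complex \<Rightarrow> complex" by (rule vector_space_complex)
  interpret VT: vector_space_pair sV sT ..
  interpret TC: vector_space_pair sT "(*) :: complex \<Rightarrow> complex \<Rightarrow> complex" ..
  define W where "W = {1..n} \<rightarrow>\<^sub>E B"
  have W: "finite W" "card W = card C" using B(1) card by (auto simp: W_def finite_PiE card_PiE)
  obtain \<phi> where \<phi>: "bij_betw \<phi> W C"
    using finite_same_card_bij[OF W(1) C(1) W(2)] by blast
  define co where "co x b = V.representation B x b" for x b
  define tens where
    "tens v = (\<Sum>w\<in>W. sT (\<Prod>i\<in>{1..n}. co (v i) (w i)) (\<phi> w))" for v :: "nat \<Rightarrow> 'v"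
  have co_basis: "co x b = (if b = x then 1 else 0)" if "x \<in> B" for x b
    using V.representation_basis[OF B(2) that] by (simp add: co_def)
  have m: "multilinear n sV sT tens"
    unfolding multilinear_def
  proof (intro conjI allI impI ballI)
    show "tens v = tens w" if "\<forall>i\<in>{1..n}. v i = w i" for v w
      using that by (simp add: tens_def)
    fix v i assume i: "i \<in> {1..n}"
    have "Vector_Spaces.linear sV sT
        (\<lambda>x. sT (\<Prod>j\<in>{1..n}. co ((v(i := x)) j) (w j)) (\<phi> w))" for w
    proof -
      have eq: "(\<Prod>j\<in>{1..n}. co ((v(i := x)) j) (w j))
          = co x (w i) * (\<Prod>j\<in>{1..n} - {i}. co (v j) (w j))" for x
        using i by (simp add: prod.remove)
      have l: "Vector_Spaces.linear sV sT (\<lambda>x. sT (co x b * c) t)" for b c t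
        unfolding Vector_Spaces.linear_iff
      proof (intro conjI allI)
        show "sT (co (x + y) b * c) t = sT (co x b * c) t + sT (co y b * c) t" for x y
          using B(2,3)
          by (simp add: co_def V.representation_add distrib_right T.scale_left_distrib)
        show "sT (co (sV a x) b * c) t = sT a (sT (co x b * c) t)" for a x
        proof -
          have "co (sV a x) b = a * co x b"
            using V.representation_scale[OF B(2), of x a] B(3) unfolding co_def by simp
          then show ?thesis by (simp only: T.scale_scale mult.assoc)
        qed
      qed (rule V T)+
      show ?thesis unfolding eq by (rule l)
    qed
    then show "Vector_Spaces.linear sV sT (\<lambda>x. tens (v(i := x)))"
      unfolding tens_def by (intro VT.linear_compose_sum ballI) auto
  qed
  have tens_basis: "tens v = \<phi> (restrict v {1..n})" if v: "\<forall>i\<in>{1..n}. v i \<in> B" for v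
  proof -
    have rv: "restrict v {1..n} \<in> W" using v by (auto simp: W_def)
    have zero: "sT (\<Prod>i\<in>{1..n}. co (v i) (w i)) (\<phi> w) = 0"
      if w: "w \<in> W - {restrict v {1..n}}" for w
    proof -
      have "w = restrict v {1..n}" if "\<forall>i\<in>{1..n}. w i = v i"
        by (rule PiE_ext[of _ "{1..n}" "\<lambda>_. B"]) (use w rv that in \<open>auto simp: W_def\<close>)
      then obtain i where i: "i \<in> {1..n}" "w i \<noteq> v i" using w by blast
      then have "co (v i) (w i) = 0" using v co_basis by auto
      then have "(\<Prod>i\<in>{1..n}. co (v i) (w i)) = 0" using i(1) by (auto intro: prod_zero)
      then show ?thesis by simp
    qed
    have "tens v = sT (\<Prod>i\<in>{1..n}. co (v i) (restrict v {1..n} i)) (\<phi> (restrict v {1..n}))"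
      unfolding tens_def by (subst sum.remove[OF W(1) rv], subst sum.neutral) (use zero in blast, simp)
    moreover have "(\<Prod>i\<in>{1..n}. co (v i) (restrict v {1..n} i)) = 1"
      using v co_basis by (intro prod.neutral) auto
    ultimately show ?thesis by simp
  qed
  have tens_W: "tens w = \<phi> w" if "w \<in> W" for w
  proof -
    have "restrict w {1..n} = w" using that by (auto simp: W_def intro: PiE_restrict)
    then show ?thesis using tens_basis[of w] that by (auto simp: W_def)
  qed
  have "\<exists>!g. Vector_Spaces.linear sT (*) g \<and> (\<forall>v. g (tens v) = f v)"
    if f: "multilinear n sV (*) f" for f :: "(nat \<Rightarrow> 'v) \<Rightarrow> complex"
  proof -
    obtain g where g: "Vector_Spaces.linear sT (*) g" "\<forall>c\<in>C. g c = f (inv_into W \<phi> c)"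
      using TC.linear_independent_extend[OF C(2), of "\<lambda>c. f (inv_into W \<phi> c)"] by blast
    have "g (tens v) = f v" for v
    proof (rule multilinear_eq_on_spanning[OF V vector_space_complex B(3) _ f,
          where f = "\<lambda>v. g (tens v)"])
      show "multilinear n sV (*) (\<lambda>v. g (tens v))" using multilinear_compose[OF m g(1)] .
      fix v :: "nat \<Rightarrow> 'v" assume v: "\<forall>i\<in>{1..n}. v i \<in> B"
      have r: "restrict v {1..n} \<in> W" using v by (auto simp: W_def)
      have "g (tens v) = f (restrict v {1..n})"
        using g(2) r \<phi> by (simp add: tens_basis[OF v] bij_betw_apply bij_betw_inv_into_left)
      also have "\<dots> = f v" using f unfolding multilinear_def by (metis restrict_apply')
      finally show "g (tens v) = f v" .
    qed
    moreover have "g' = g"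
      if g': "Vector_Spaces.linear sT (*) g'" "\<forall>v. g' (tens v) = f v" for g'
    proof
      fix x
      show "g' x = g x"
      proof (rule TC.linear_eq_on[OF g'(1) g(1)])
        show "x \<in> T.span C" using C(3) by simp
        fix c assume "c \<in> C"
        then obtain w where w: "w \<in> W" "c = \<phi> w" using \<phi> by (auto simp: bij_betw_def)
        then show "g' c = g c" using g'(2) calculation tens_W by metis
      qed
    qed
    ultimately show ?thesis using g(1) by blast
  qed
  then show ?thesis using V T m unfolding tensor_power_def by blast
qed


section \<open>The sign permutation action\<close>

text \<open>Only used for homogeneous vectors, that is, for elements of \<open>V0 \<union> V1\<close>.\<close>

definition degree :: "'v set \<Rightarrow> 'v \<Rightarrow> nat" where
  "degree V0 x = (if x \<in> V0 then 0 else 1)"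

definition perm_sign :: "nat \<Rightarrow> 'v set \<Rightarrow> (nat \<Rightarrow> nat) \<Rightarrow> (nat \<Rightarrow> 'v) \<Rightarrow> complex" where
  "perm_sign n V0 \<sigma> v =
     (\<Prod>(i, j) \<in> {(i, j). i \<in> {1..n} \<and> j \<in> {1..n} \<and> i < j \<and> \<sigma> i > \<sigma> j}.
        (-1) ^ (degree V0 (v i) * degree V0 (v j)))"

text \<open>Well defined for \<open>\<sigma>\<close> permuting \<open>{1..n}\<close>: see \<open>sign_action_ex1\<close> below.\<close>

definition sign_action ::
  "nat \<Rightarrow> 'v set \<Rightarrow> 'v set \<Rightarrow> (complex \<Rightarrow> 't::ab_group_add \<Rightarrow> 't) \<Rightarrow> ((nat \<Rightarrow> 'v) \<Rightarrow> 't)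
    \<Rightarrow> (nat \<Rightarrow> nat) \<Rightarrow> 't \<Rightarrow> 't" where
  "sign_action n V0 V1 sT tens \<sigma> =
     (THE f. Vector_Spaces.linear sT sT f \<and>
        (\<forall>v. (\<forall>i\<in>{1..n}. v i \<in> V0 \<union> V1) \<longrightarrow>
           f (tens v) = sT (perm_sign n V0 \<sigma> v) (tens (v \<circ> Hilbert_Choice.inv \<sigma>))))"

lemma z2_graded_span:
  assumes "z2_graded sV V0 V1"
  shows "module.span sV (V0 \<union> V1) = UNIV"
proof -
  interpret vector_space sV using assms by (simp add: z2_graded_def)
  have "x \<in> span (V0 \<union> V1)" for x
  proof -
    obtain a b where "a \<in> V0" "b \<in> V1" "x = a + b" using assms unfolding z2_graded_def by blast
    then show ?thesis using span_add span_base by (metis UnCI)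
  qed
  then show ?thesis by blast
qed

lemma graded_projections:
  assumes V: "z2_graded sV V0 V1"
  obtains p0 p1 where "Vector_Spaces.linear sV sV p0" "Vector_Spaces.linear sV sV p1"
    "\<And>x. x \<in> V0 \<Longrightarrow> p0 x = x \<and> p1 x = 0" "\<And>x. x \<in> V1 \<Longrightarrow> p0 x = 0 \<and> p1 x = x"
proof -
  interpret vector_space sV using V by (simp add: z2_graded_def)
  interpret vector_space_pair sV sV ..
  have s: "subspace V0" "subspace V1" "V0 \<inter> V1 = {0}" using V by (auto simp: z2_graded_def)
  obtain p0 p1 where p: "\<And>x. p0 x \<in> V0" "\<And>x. p1 x \<in> V1" "\<And>x. x = p0 x + p1 x"
    using V unfolding z2_graded_def by metis
  have un: "a = p0 (a + b) \<and> b = p1 (a + b)" if "a \<in> V0" "b \<in> V1" for a b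
  proof -
    have e: "a + b = p0 (a + b) + p1 (a + b)" using p(3) .
    then have "a - p0 (a + b) = p1 (a + b) - b" by (simp add: algebra_simps)
    moreover have "a - p0 (a + b) \<in> V0" "p1 (a + b) - b \<in> V1"
      using s p that subspace_diff by auto
    ultimately have "a - p0 (a + b) = 0" using s(3) by (metis IntI singletonD)
    then show ?thesis using e by (metis add_left_cancel eq_iff_diff_eq_0)
  qed
  have z: "0 \<in> V0" "0 \<in> V1" using s subspace_0 by auto
  have add: "p0 (x + y) = p0 x + p0 y \<and> p1 (x + y) = p1 x + p1 y" for x y
  proof -
    have "x + y = (p0 x + p0 y) + (p1 x + p1 y)" by (metis p(3) add.assoc add.left_commute)
    moreover have "p0 x + p0 y \<in> V0" "p1 x + p1 y \<in> V1" using s p subspace_add by auto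
    ultimately show ?thesis using un by metis
  qed
  have sc: "p0 (sV c x) = sV c (p0 x) \<and> p1 (sV c x) = sV c (p1 x)" for x c
  proof -
    have "sV c x = sV c (p0 x) + sV c (p1 x)" by (metis p(3) scale_right_distrib)
    moreover have "sV c (p0 x) \<in> V0" "sV c (p1 x) \<in> V1" using s p subspace_scale by auto
    ultimately show ?thesis using un by metis
  qed
  show ?thesis
  proof (rule that)
    show "Vector_Spaces.linear sV sV p0" "Vector_Spaces.linear sV sV p1"
      using add sc by (auto simp: Vector_Spaces.linear_iff vector_space_axioms)
    show "p0 x = x \<and> p1 x = 0" if "x \<in> V0" for x using un[OF that z(2)] by simp
    show "p0 x = 0 \<and> p1 x = x" if "x \<in> V1" for x using un[OF z(1) that] by simp
  qed
qed

theorem sign_action_ex1: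
  assumes V: "z2_graded sV V0 V1" and T: "tensor_power n sV sT tens"
    and \<sigma>: "\<sigma> permutes {1..n}"
  shows "\<exists>!f. Vector_Spaces.linear sT sT f \<and>
    (\<forall>v. (\<forall>i\<in>{1..n}. v i \<in> V0 \<union> V1) \<longrightarrow>
       f (tens v) = sT (perm_sign n V0 \<sigma> v) (tens (v \<circ> Hilbert_Choice.inv \<sigma>)))"
proof -
  have vs: "vector_space sV" "vector_space sT" and m: "multilinear n sV sT tens"
    using T by (auto simp: tensor_power_def)
  interpret V: vector_space sV by fact
  interpret T: vector_space sT by fact
  interpret VT: vector_space_pair sV sT ..
  interpret TT: vector_space_pair sT sT ..
  obtain p0 p1 where p: "Vector_Spaces.linear sV sV p0" "Vector_Spaces.linear sV sV p1"
    and p0: "\<And>x. x \<in> V0 \<Longrightarrow> p0 x = x \<and> p1 x = 0" and p1: "\<And>x. x \<in> V1 \<Longrightarrow> p0 x = 0 \<and> p1 x = x"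
    by (rule graded_projections[OF V]) blast
  let ?\<tau> = "Hilbert_Choice.inv \<sigma>"
  have \<tau>: "?\<tau> permutes {1..n}" using \<sigma> by (rule permutes_inv)
  have st: "?\<tau> (\<sigma> i) = i" "\<sigma> (?\<tau> i) = i" for i using permutes_inverses[OF \<sigma>] by auto
  have si: "\<sigma> i \<in> {1..n} \<longleftrightarrow> i \<in> {1..n}" "?\<tau> i \<in> {1..n} \<longleftrightarrow> i \<in> {1..n}" for i
    using permutes_in_image[OF \<sigma>] permutes_in_image[OF \<tau>] by auto
  define q where "q S v i = (if i \<in> S then p1 (v i) else p0 (v i))" for S v and i :: nat
  define e where "e S = (\<Prod>(i, j) \<in> {(i, j). i \<in> {1..n} \<and> j \<in> {1..n} \<and> i < j \<and> \<sigma> i > \<sigma> j}.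
        (-1::complex) ^ (of_bool (i \<in> S) * of_bool (j \<in> S)))" for S
  define F where "F v = (\<Sum>S\<in>Pow {1..n}. sT (e S) (tens (q S v \<circ> ?\<tau>)))" for v
  have cong: "tens v = tens w" if "\<And>i. i \<in> {1..n} \<Longrightarrow> v i = w i" for v w
    using m that unfolding multilinear_def by blast
  have zero: "tens v = 0" if "i \<in> {1..n}" "v i = 0" for i v
  proof -
    interpret L: Vector_Spaces.linear sV sT "\<lambda>x. tens (v(i := x))"
      by (rule multilinearD[OF m that(1)])
    show ?thesis using L.zero that(2) by (metis fun_upd_triv)
  qed
  have F: "multilinear n sV sT F"
    unfolding multilinear_def
  proof (intro conjI allI impI ballI)
    fix v w :: "nat \<Rightarrow> 'a" assume vw: "\<forall>i\<in>{1..n}. v i = w i"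
    have "tens (q S v \<circ> ?\<tau>) = tens (q S w \<circ> ?\<tau>)" for S
      by (rule cong) (use vw si in \<open>auto simp: q_def\<close>)
    then show "F v = F w" by (simp add: F_def)
  next
    fix v i assume i: "i \<in> {1..n}"
    have "Vector_Spaces.linear sV sT (\<lambda>x. tens (q S (v(i := x)) \<circ> ?\<tau>))" for S
    proof -
      have eq: "q S (v(i := x)) \<circ> ?\<tau> = (q S v \<circ> ?\<tau>)(\<sigma> i := (if i \<in> S then p1 x else p0 x))" for x
        using st by (fastforce simp: q_def)
      have l: "Vector_Spaces.linear sV sT (\<lambda>x. tens ((q S v \<circ> ?\<tau>)(\<sigma> i := x)))"
        by (rule multilinearD[OF m]) (use i si in auto)
      show ?thesis unfolding eq
        using Vector_Spaces.linear_compose[OF p(1) l] Vector_Spaces.linear_compose[OF p(2) l]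
        by (cases "i \<in> S") (simp_all add: o_def)
    qed
    then show "Vector_Spaces.linear sV sT (\<lambda>x. F (v(i := x)))"
      unfolding F_def by (intro VT.linear_compose_sum ballI VT.linear_compose_scale_right) auto
  qed
  have Fhom: "F v = sT (perm_sign n V0 \<sigma> v) (tens (v \<circ> ?\<tau>))"
    if v: "\<forall>i\<in>{1..n}. v i \<in> V0 \<union> V1" for v
  proof -
    define S0 where "S0 = {i\<in>{1..n}. v i \<notin> V0}"
    have "tens (q S v \<circ> ?\<tau>) = 0" if S: "S \<in> Pow {1..n} - {S0}" for S
    proof -
      have "S \<noteq> S0" "S \<subseteq> {1..n}" "S0 \<subseteq> {1..n}" using S by (auto simp: S0_def)
      then obtain i where i: "i \<in> {1..n}" "i \<in> S \<longleftrightarrow> i \<notin> S0" by blast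
      have "q S v i = 0" using i v p0 p1 by (auto simp: q_def S0_def)
      then have "(q S v \<circ> ?\<tau>) (\<sigma> i) = 0" by (simp add: st)
      then show ?thesis using zero[of "\<sigma> i"] si i by blast
    qed
    then have "F v = sT (e S0) (tens (q S0 v \<circ> ?\<tau>))"
      unfolding F_def by (subst sum.remove[of _ S0]) (auto simp: S0_def)
    moreover have "e S0 = perm_sign n V0 \<sigma> v"
      unfolding e_def perm_sign_def by (rule prod.cong) (auto simp: S0_def degree_def)
    moreover have "tens (q S0 v \<circ> ?\<tau>) = tens (v \<circ> ?\<tau>)"
    proof (rule cong)
      fix i assume "i \<in> {1..n}"
      then have "?\<tau> i \<in> {1..n}" using si by blast
      then show "(q S0 v \<circ> ?\<tau>) i = (v \<circ> ?\<tau>) i" using v p0 p1 by (auto simp: q_def S0_def)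
    qed
    ultimately show ?thesis by simp
  qed
  obtain f where f: "Vector_Spaces.linear sT sT f" "\<And>v. f (tens v) = F v"
    using tensor_power_universal[OF T vs(2) F] by blast
  show ?thesis
  proof (rule ex1I[of _ f])
    show "Vector_Spaces.linear sT sT f \<and>
      (\<forall>v. (\<forall>i\<in>{1..n}. v i \<in> V0 \<union> V1) \<longrightarrow>
       f (tens v) = sT (perm_sign n V0 \<sigma> v) (tens (v \<circ> ?\<tau>)))" using f Fhom by simp
    fix f' assume f': "Vector_Spaces.linear sT sT f' \<and>
      (\<forall>v. (\<forall>i\<in>{1..n}. v i \<in> V0 \<union> V1) \<longrightarrow>
       f' (tens v) = sT (perm_sign n V0 \<sigma> v) (tens (v \<circ> ?\<tau>)))"
    have eq: "f' (tens v) = f (tens v)" for v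
    proof (rule multilinear_eq_on_spanning[OF vs z2_graded_span[OF V],
          where f = "\<lambda>v. f' (tens v)" and g = "\<lambda>v. f (tens v)"])
      show "multilinear n sV sT (\<lambda>v. f' (tens v))" "multilinear n sV sT (\<lambda>v. f (tens v))"
        using multilinear_compose[OF m] f(1) f' by blast+
      show "f' (tens v) = f (tens v)" if "\<forall>i\<in>{1..n}. v i \<in> V0 \<union> V1" for v
        using f' f(2)[of v] Fhom[OF that] that by simp
    qed
    show "f' = f"
    proof
      fix x show "f' x = f x"
        by (rule TT.linear_eq_on[of f' f x "range tens"])
          (use f' f(1) eq tensor_power_span[OF T] in auto)
    qed
  qed
qed


section \<open>Algebras, automorphisms and crossed products\<close>

text \<open>A complex algebra is a record of type \<open>(complex, 'a) module\<close>; the locale \<open>algebra\<close> of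
  HOL-Algebra is not used since it requires commutativity.\<close>

definition commutant ::
  "(complex \<Rightarrow> 't::ab_group_add \<Rightarrow> 't) \<Rightarrow> ('t \<Rightarrow> 't) set \<Rightarrow> (complex, 't \<Rightarrow> 't) module" where
  "commutant s S =
     \<lparr>carrier = {f. Vector_Spaces.linear s s f \<and> (\<forall>g\<in>S. f \<circ> g = g \<circ> f)},
      mult = (\<circ>), one = id, zero = (\<lambda>x. 0), add = (\<lambda>f g x. f x + g x),
      smult = (\<lambda>c f x. s c (f x))\<rparr>"

definition alg_B ::
  "nat \<Rightarrow> 'v set \<Rightarrow> 'v set \<Rightarrow> (complex \<Rightarrow> 't::ab_group_add \<Rightarrow> 't) \<Rightarrow> ((nat \<Rightarrow> 'v) \<Rightarrow> 't)
    \<Rightarrow> (complex, 't \<Rightarrow> 't) module" where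
  "alg_B n V0 V1 sT tens = commutant sT (sign_action n V0 V1 sT tens ` carrier (sym_group n))"

definition alg_A ::
  "nat \<Rightarrow> 'v set \<Rightarrow> 'v set \<Rightarrow> (complex \<Rightarrow> 't::ab_group_add \<Rightarrow> 't) \<Rightarrow> ((nat \<Rightarrow> 'v) \<Rightarrow> 't)
    \<Rightarrow> (complex, 't \<Rightarrow> 't) module" where
  "alg_A n V0 V1 sT tens = commutant sT (sign_action n V0 V1 sT tens ` carrier (alt_group n))"

definition alg_iso ::
  "(complex, 'a) module \<Rightarrow> (complex, 'b) module \<Rightarrow> ('a \<Rightarrow> 'b) set" where
  "alg_iso R S =
     {h \<in> ring_iso R S. \<forall>c. \<forall>x\<in>carrier R. h (c \<odot>\<^bsub>R\<^esub> x) = c \<odot>\<^bsub>S\<^esub> h x}"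

text \<open>As for \<open>AutoGroup\<close>, automorphisms are extensional functions on the carrier.\<close>

definition alg_aut_group :: "(complex, 'a) module \<Rightarrow> ('a \<Rightarrow> 'a) monoid" where
  "alg_aut_group R = BijGroup (carrier R) \<lparr>carrier := alg_iso R R \<inter> Bij (carrier R)\<rparr>"

text \<open>For a finite group \<open>G\<close> of automorphisms of \<open>R\<close>, the element \<open>\<Sum>\<^sub>g r\<^sub>g \<otimes> g\<close> of
  \<open>R \<otimes> \<complex>G\<close> is represented by its coefficient function \<open>g \<mapsto> r\<^sub>g\<close>, and \<open>mult\<close> is the bilinear
  extension of \<open>(r\<^sub>1 \<otimes> g\<^sub>1)(r\<^sub>2 \<otimes> g\<^sub>2) = r\<^sub>1 g\<^sub>1(r\<^sub>2) \<otimes> g\<^sub>1g\<^sub>2\<close>.\<close>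

definition crossed_product ::
  "(complex, 'a) module \<Rightarrow> ('a \<Rightarrow> 'a) monoid \<Rightarrow> (complex, ('a \<Rightarrow> 'a) \<Rightarrow> 'a) module" where
  "crossed_product R G =
     \<lparr>carrier = carrier G \<rightarrow>\<^sub>E carrier R,
      mult = (\<lambda>a b. \<lambda>g\<in>carrier G.
        \<Oplus>\<^bsub>R\<^esub>p \<in> {(g1, g2) \<in> carrier G \<times> carrier G. g1 \<otimes>\<^bsub>G\<^esub> g2 = g}.
          a (fst p) \<otimes>\<^bsub>R\<^esub> (fst p) (b (snd p))),
      one = (\<lambda>g\<in>carrier G. if g = \<one>\<^bsub>G\<^esub> then \<one>\<^bsub>R\<^esub> else \<zero>\<^bsub>R\<^esub>),
      zero = (\<lambda>g\<in>carrier G. \<zero>\<^bsub>R\<^esub>),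
      add = (\<lambda>a b. \<lambda>g\<in>carrier G. a g \<oplus>\<^bsub>R\<^esub> b g),
      smult = (\<lambda>c a. \<lambda>g\<in>carrier G. c \<odot>\<^bsub>R\<^esub> a g)\<rparr>"

text \<open>Meaningful when scalar multiplication makes the whole type a vector space and the carrier
  is a subspace, as for \<open>commutant\<close> with the pointwise operations on functions.\<close>

definition alg_dim :: "(complex, 'a::ab_group_add) module \<Rightarrow> nat" where
  "alg_dim R = vector_space.dim (smult R) (carrier R)"

end

theory Submission
  imports Defs
begin

text \<open>An odd involution \<open>\<theta>\<close> of \<open>V\<close> interchanges \<open>V0\<close> and \<open>V1\<close>, which is possible since they have the
  same dimension.  With Koszul signs, \<open>\<theta> \<otimes> \<dots> \<otimes> \<theta>\<close> becomes an involution \<open>u\<close> of the tensor power that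
  commutes with the action of even permutations and anticommutes with that of odd ones.  Hence
  \<open>u\<close> lies in the commutant of the alternating group and normalizes the commutant of the
  symmetric group, and the former algebra is the direct sum of the latter and its translate by
  \<open>u\<close>.  This is the crossed product by the group generated by conjugation with \<open>u\<close>, which has order
  two because conjugation with \<open>u\<close> sends the projection onto \<open>V0 \<otimes> \<dots> \<otimes> V0\<close> to the one
  onto \<open>V1 \<otimes> \<dots> \<otimes> V1\<close>.\<close>

section \<open>Commutants and an odd involution\<close>

lemma carrier_commutant:
  "f \<in> carrier (commutant s S) \<longleftrightarrow> Vector_Spaces.linear s s f \<and> (\<forall>g\<in>S. f \<circ> g = g \<circ> f)"
  by (simp add: commutant_def)

lemma commutant_simps [simp]:
  "f \<otimes>\<^bsub>commutant s S\<^esub> g = f \<circ> g"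
  "\<one>\<^bsub>commutant s S\<^esub> = id"
  "\<zero>\<^bsub>commutant s S\<^esub> = (\<lambda>x. 0)"
  "f \<oplus>\<^bsub>commutant s S\<^esub> g = (\<lambda>x. f x + g x)"
  "c \<odot>\<^bsub>commutant s S\<^esub> f = (\<lambda>x. s c (f x))"
  "smult (commutant s S) = (\<lambda>c f x. s c (f x))"
  by (simp_all add: commutant_def)

lemma linear_rules:
  assumes "Vector_Spaces.linear s s' f"
  shows "f (x + y) = f x + f y" "f (s c x) = s' c (f x)" "f 0 = 0" "f (- x) = - f x"
    "f (x - y) = f x - f y"
proof -
  interpret Vector_Spaces.linear s s' f by fact
  show "f (x + y) = f x + f y" "f (s c x) = s' c (f x)" "f 0 = 0" "f (- x) = - f x"
    "f (x - y) = f x - f y"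
    by (simp_all add: add scale neg diff)
qed

lemma
  assumes "vector_space s" and S: "\<And>g. g \<in> S \<Longrightarrow> Vector_Spaces.linear s s g"
  shows zero_commutant: "(\<lambda>x. 0) \<in> carrier (commutant s S)"
    and id_commutant: "id \<in> carrier (commutant s S)"
    and add_commutant: "\<lbrakk>f \<in> carrier (commutant s S); g \<in> carrier (commutant s S)\<rbrakk>
      \<Longrightarrow> (\<lambda>x. f x + g x) \<in> carrier (commutant s S)"
    and comp_commutant: "\<lbrakk>f \<in> carrier (commutant s S); g \<in> carrier (commutant s S)\<rbrakk>
      \<Longrightarrow> f \<circ> g \<in> carrier (commutant s S)"
    and scale_commutant: "f \<in> carrier (commutant s S)
      \<Longrightarrow> (\<lambda>x. s c (f x)) \<in> carrier (commutant s S)"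
proof -
  interpret vector_space s by fact
  note l = linear_rules[OF S]
  show "(\<lambda>x. 0) \<in> carrier (commutant s S)" "id \<in> carrier (commutant s S)"
    using l by (auto simp: carrier_commutant Vector_Spaces.linear_iff fun_eq_iff vector_space_axioms)
  show "(\<lambda>x. f x + g x) \<in> carrier (commutant s S)" "f \<circ> g \<in> carrier (commutant s S)"
    if "f \<in> carrier (commutant s S)" "g \<in> carrier (commutant s S)"
    using that l by (auto simp: carrier_commutant Vector_Spaces.linear_iff fun_eq_iff algebra_simps)
  show "(\<lambda>x. s c (f x)) \<in> carrier (commutant s S)" if "f \<in> carrier (commutant s S)"
    using that l by (auto simp: carrier_commutant Vector_Spaces.linear_iff fun_eq_iff algebra_simps)
qed

text \<open>The ring laws are what allows the finite sums in the crossed product over a commutant to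
  be evaluated.\<close>

lemma ring_commutant:
  assumes "vector_space s" and S: "\<And>g. g \<in> S \<Longrightarrow> Vector_Spaces.linear s s g"
  shows "ring (commutant s S)"
proof (rule ringI)
  interpret vector_space s by fact
  note closed = zero_commutant[of s S, OF assms] id_commutant[of s S, OF assms]
    add_commutant[of s S, OF assms] comp_commutant[of s S, OF assms]
    scale_commutant[of s S, OF assms]
  show "abelian_group (commutant s S)"
  proof (rule abelian_groupI)
    show "\<exists>y\<in>carrier (commutant s S). y \<oplus>\<^bsub>commutant s S\<^esub> f = \<zero>\<^bsub>commutant s S\<^esub>"
      if "f \<in> carrier (commutant s S)" for f
    proof
      show "(\<lambda>x. - f x) \<in> carrier (commutant s S)" using closed(5)[OF _ that, of "-1"] by simp
    qed simp
  qed (use closed in \<open>auto simp: algebra_simps\<close>)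
  show "monoid (commutant s S)"
    by (rule monoidI) (use closed in \<open>auto simp: o_assoc\<close>)
qed (auto simp: carrier_commutant fun_eq_iff Vector_Spaces.linear_iff)

text \<open>If \<open>a\<close> in \<open>S\<close> lies in the span of the remaining vectors, then
  \<open>a = x + y\<close> with \<open>x\<close> in the span of \<open>S - {a}\<close> and
  \<open>y\<close> in the span of \<open>T\<close>. Then \<open>y = a - x\<close> lies in both
  spans, so it vanishes and \<open>a\<close> already depends on \<open>S - {a}\<close>.\<close>

lemma independent_Un_disjoint_span:
  assumes "vector_space s" and "\<not> module.dependent s S" "\<not> module.dependent s T"
    and "module.span s S \<inter> module.span s T = {0}"
  shows "\<not> module.dependent s (S \<union> T)"
proof -
  interpret vector_space s by fact
  \<comment> \<open>Kept generic in \<open>S\<close> and \<open>T\<close>, so that the case of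
    \<open>a\<close> in the second set follows by exchanging the two.\<close>
  have *: False if "independent S" "span S \<inter> span T = {0}" "a \<in> S" "a \<in> span ((S \<union> T) - {a})"
    for a S T
  proof -
    have "a \<in> span ((S - {a}) \<union> T)" using that(4) span_mono[of "(S \<union> T) - {a}" "(S - {a}) \<union> T"] by blast
    then obtain x y where xy: "a = x + y" "x \<in> span (S - {a})" "y \<in> span T"
      unfolding span_Un by blast
    have "x \<in> span S" using xy(2) span_mono[of "S - {a}" S] by blast
    then have "y \<in> span S" using xy(1) that(3) span_diff[of a S x] span_base by simp
    then have "y = 0" using xy(3) that(2) by blast
    then show False using xy that(1,3) unfolding dependent_def by auto
  qed
  show ?thesis
    using *[of S T] *[of T S] assms(2-4) unfolding dependent_def[of "S \<union> T"]
    by (auto simp: Int_commute Un_commute)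
qed

text \<open>\<open>G0\<close> and \<open>G1\<close> stand for the operators of the even and odd
  permutations and \<open>t\<close> for that of a transposition. The index two of the alternating
  group enters as the fact that composition with \<open>t\<close>, on either side, exchanges the two
  sets.\<close>

locale odd_involution =
  fixes s :: "complex \<Rightarrow> 't::ab_group_add \<Rightarrow> 't" and G0 G1 :: "('t \<Rightarrow> 't) set" and t u :: "'t \<Rightarrow> 't"
  assumes vs: "vector_space s"
    and linG: "g \<in> G0 \<union> G1 \<Longrightarrow> Vector_Spaces.linear s s g"
    and t: "t \<in> G1" and tt: "t (t x) = x"
    and tG: "g \<in> G1 \<Longrightarrow> t \<circ> g \<in> G0" and Gt: "g \<in> G1 \<Longrightarrow> g \<circ> t \<in> G0"
    and tGt: "g \<in> G0 \<Longrightarrow> t \<circ> g \<in> G1" "g \<in> G0 \<Longrightarrow> g \<circ> t \<in> G1"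
    and linu: "Vector_Spaces.linear s s u" and uu: "u (u x) = x"
    and uG0: "g \<in> G0 \<Longrightarrow> u (g x) = g (u x)" and uG1: "g \<in> G1 \<Longrightarrow> u (g x) = - g (u x)"
begin

sublocale vector_space s by (rule vs)

abbreviation "Bc \<equiv> carrier (commutant s (G0 \<union> G1))"
abbreviation "Ac \<equiv> carrier (commutant s G0)"

lemma linG_rules:
  assumes "g \<in> G0 \<union> G1"
  shows "g (x + y) = g x + g y" "g (s c x) = s c (g x)" "g 0 = 0" "g (- x) = - g x"
    "g (x - y) = g x - g y"
  using linear_rules[OF linG[OF assms]] by auto

lemmas t_rules = linG_rules[OF UnI2[OF t]]
lemmas u_rules = linear_rules[OF linu]

lemma A_rules:
  assumes "f \<in> Ac"
  shows "f (x + y) = f x + f y" "f (s c x) = s c (f x)" "f 0 = 0" "f (- x) = - f x"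
    "f (x - y) = f x - f y" "g \<in> G0 \<Longrightarrow> f (g x) = g (f x)"
  using linear_rules[of s s f] assms by (auto simp: carrier_commutant fun_eq_iff)

lemma B_subset_A: "f \<in> Bc \<Longrightarrow> f \<in> Ac" by (auto simp: carrier_commutant)

lemma B_rules:
  assumes "f \<in> Bc"
  shows "f (x + y) = f x + f y" "f (s c x) = s c (f x)" "f 0 = 0" "f (- x) = - f x"
    "f (x - y) = f x - f y" "g \<in> G0 \<Longrightarrow> f (g x) = g (f x)" "g \<in> G1 \<Longrightarrow> f (g x) = g (f x)"
  using A_rules[OF B_subset_A[OF assms]] assms by (auto simp: carrier_commutant fun_eq_iff)

lemma AI:
  assumes "\<And>x y. f (x + y) = f x + f y" "\<And>c x. f (s c x) = s c (f x)"
    "\<And>g x. g \<in> G0 \<Longrightarrow> f (g x) = g (f x)"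
  shows "f \<in> Ac"
  using assms by (auto simp: carrier_commutant Vector_Spaces.linear_iff vs fun_eq_iff)

lemma BI:
  assumes "\<And>x y. f (x + y) = f x + f y" "\<And>c x. f (s c x) = s c (f x)"
    "\<And>g x. g \<in> G0 \<Longrightarrow> f (g x) = g (f x)" "\<And>g x. g \<in> G1 \<Longrightarrow> f (g x) = g (f x)"
  shows "f \<in> Bc"
  using assms by (auto simp: carrier_commutant Vector_Spaces.linear_iff vs fun_eq_iff)

lemma A_closed:
  "(\<lambda>x. 0) \<in> Ac" "id \<in> Ac"
  "\<lbrakk>f \<in> Ac; g \<in> Ac\<rbrakk> \<Longrightarrow> (\<lambda>x. f x + g x) \<in> Ac"
  "\<lbrakk>f \<in> Ac; g \<in> Ac\<rbrakk> \<Longrightarrow> f \<circ> g \<in> Ac"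
  "f \<in> Ac \<Longrightarrow> (\<lambda>x. s c (f x)) \<in> Ac"
  using vs linG
  by (auto intro: zero_commutant id_commutant add_commutant comp_commutant scale_commutant)

lemma B_closed:
  "(\<lambda>x. 0) \<in> Bc" "id \<in> Bc"
  "\<lbrakk>f \<in> Bc; g \<in> Bc\<rbrakk> \<Longrightarrow> (\<lambda>x. f x + g x) \<in> Bc"
  "\<lbrakk>f \<in> Bc; g \<in> Bc\<rbrakk> \<Longrightarrow> f \<circ> g \<in> Bc"
  "f \<in> Bc \<Longrightarrow> (\<lambda>x. s c (f x)) \<in> Bc"
  using vs linG
  by (auto intro: zero_commutant id_commutant add_commutant comp_commutant scale_commutant)

text \<open>Every \<open>f\<close> in the large algebra splits as \<open>f = b + c \<circ> u\<close> with \<open>b, c\<close> in the small one: the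
  symmetric part of \<open>f\<close> under conjugation by \<open>t\<close> is \<open>b\<close>, and the antisymmetric part becomes
  symmetric after composing with \<open>u\<close>.\<close>

definition sym_part :: "('t \<Rightarrow> 't) \<Rightarrow> 't \<Rightarrow> 't" where
  "sym_part f x = s (1/2) (f x + t (f (t x)))"

definition alt_part :: "('t \<Rightarrow> 't) \<Rightarrow> 't \<Rightarrow> 't" where
  "alt_part f x = s (1/2) (f (u x) - t (f (t (u x))))"

definition conj_u :: "('t \<Rightarrow> 't) \<Rightarrow> 't \<Rightarrow> 't" where
  "conj_u f x = u (f (u x))"

definition join :: "('t \<Rightarrow> 't) \<Rightarrow> ('t \<Rightarrow> 't) \<Rightarrow> 't \<Rightarrow> 't" where
  "join b c x = b x + c (u x)"

lemma half: "s (1/2) x + s (1/2) x = x"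
  by (simp add: scale_left_distrib [symmetric])

lemma half2: "s (1/2) (x + x) = x"
  by (simp add: scale_right_distrib half)

text \<open>For odd \<open>g\<close> both \<open>t \<circ> g\<close> and \<open>g \<circ> t\<close>
  are even, so \<open>f\<close> commutes with them. As \<open>t\<close> is an involution, moving
  \<open>f\<close> past any odd operator replaces \<open>f\<close> by its conjugate under
  \<open>t\<close>, and that conjugate by \<open>f\<close>.\<close>

lemma twist:
  assumes f: "f \<in> Ac"
  shows "g \<in> G0 \<Longrightarrow> t (f (t (g x))) = g (t (f (t x)))"
    and "g \<in> G1 \<Longrightarrow> f (g x) = g (t (f (t x)))"
    and "g \<in> G1 \<Longrightarrow> t (f (t (g x))) = g (f x)"
proof -
  have 1: "f (g x) = g (t (f (t x)))" if "g \<in> G1" for g x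
    using A_rules(6)[OF f Gt[OF that], of "t x"] by (simp add: tt)
  have 2: "t (f (t (g x))) = g (f x)" if "g \<in> G1" for g x
    using A_rules(6)[OF f tG[OF that], of x] by (simp add: tt)
  show "g \<in> G1 \<Longrightarrow> f (g x) = g (t (f (t x)))" "g \<in> G1 \<Longrightarrow> t (f (t (g x))) = g (f x)"
    using 1 2 by auto
  assume "g \<in> G0"
  then have "f ((t \<circ> g) x) = (t \<circ> g) (t (f (t x)))" using 1 tGt by blast
  then show "t (f (t (g x))) = g (t (f (t x)))" by (simp add: tt)
qed

text \<open>Moving an odd operator past the sum exchanges its two summands, by \<open>twist\<close>;
  moving an even one fixes both.\<close>

lemma sym_part_closed: assumes f: "f \<in> Ac" shows "sym_part f \<in> Bc"
proof (rule BI)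
  show "sym_part f (g x) = g (sym_part f x)" if "g \<in> G0" for g x
    using that twist(1)[OF f] by (simp add: sym_part_def A_rules[OF f] linG_rules)
  show "sym_part f (g x) = g (sym_part f x)" if "g \<in> G1" for g x
    using that twist(2,3)[OF f, of g] by (simp add: sym_part_def linG_rules add.commute)
qed (simp_all add: sym_part_def A_rules[OF f] t_rules algebra_simps)

text \<open>An odd operator changes the sign once when it passes \<open>u\<close> and once more when
  it passes the difference of \<open>f\<close> and its conjugate under \<open>t\<close>. The two
  signs cancel.\<close>

lemma alt_part_closed: assumes f: "f \<in> Ac" shows "alt_part f \<in> Bc"
proof (rule BI)
  show "alt_part f (g x) = g (alt_part f x)" if "g \<in> G0" for g x
    using that twist(1)[OF f] by (simp add: alt_part_def A_rules[OF f] linG_rules uG0)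
  show "alt_part f (g x) = g (alt_part f x)" if "g \<in> G1" for g x
    using that twist(2,3)[OF f, of g] by (simp add: alt_part_def linG_rules uG1 A_rules[OF f] t_rules)
qed (simp_all add: alt_part_def A_rules[OF f] t_rules u_rules algebra_simps)

lemma conj_u_closed: assumes f: "f \<in> Bc" shows "conj_u f \<in> Bc"
  by (rule BI) (simp_all add: conj_u_def B_rules[OF f] u_rules uG0 uG1)

lemma join_closed: assumes b: "b \<in> Bc" and c: "c \<in> Bc" shows "join b c \<in> Ac"
  by (rule AI) (simp_all add: join_def B_rules[OF b] B_rules[OF c] u_rules uG0 linG_rules algebra_simps)

lemma join_parts: "join (sym_part f) (alt_part f) = f"
  by (rule ext) (simp add: join_def sym_part_def alt_part_def uu scale_right_distrib [symmetric] half2)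

text \<open>Since \<open>u\<close> anticommutes with \<open>t\<close>, conjugation by
  \<open>t\<close> fixes \<open>b\<close> and negates \<open>c \<circ> u\<close>. Together with
  \<open>alt_part_join\<close> this gives uniqueness of the decomposition.\<close>

lemma sym_part_join: assumes b: "b \<in> Bc" and c: "c \<in> Bc" shows "sym_part (join b c) = b"
  by (rule ext)
    (simp add: sym_part_def join_def t_rules uG1[OF t] tt B_rules(4,7)[OF b] B_rules(4,7)[OF c] t half2)

lemma alt_part_join: assumes b: "b \<in> Bc" and c: "c \<in> Bc" shows "alt_part (join b c) = c"
  by (rule ext)
    (simp add: alt_part_def join_def t_rules uG1[OF t] tt uu B_rules(4,7)[OF b] B_rules(4,7)[OF c] t half2)

lemma conj_u_conj_u: "conj_u (conj_u f) = f"
  by (rule ext) (simp add: conj_u_def uu)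

text \<open>Moving \<open>u\<close> to the right past an element of the small algebra conjugates
  that element by \<open>u\<close>, and two adjacent copies of \<open>u\<close> cancel. This is the
  twist in the crossed product multiplication.\<close>

lemma join_mult:
  assumes "b \<in> Bc" "c \<in> Bc" "b' \<in> Bc" "c' \<in> Bc"
  shows "join b c \<circ> join b' c' =
    join (\<lambda>x. b (b' x) + c (conj_u c' x)) (\<lambda>x. b (c' x) + c (conj_u b' x))"
  by (rule ext)
    (simp add: join_def conj_u_def uu u_rules B_rules[OF assms(1)] B_rules[OF assms(2)] algebra_simps)

section \<open>The automorphism group generated by conjugation with the involution\<close>

abbreviation "B \<equiv> commutant s (G0 \<union> G1)"
abbreviation "A \<equiv> commutant s G0"

definition "\<iota> = (\<lambda>f\<in>Bc. f)"
definition "\<alpha> = (\<lambda>f\<in>Bc. conj_u f)"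
definition "H = {\<iota>, \<alpha>}"
abbreviation "AutH \<equiv> (alg_aut_group B)\<lparr>carrier := H\<rparr>"

lemma alpha_apply: "f \<in> Bc \<Longrightarrow> \<alpha> f = conj_u f"
  unfolding \<alpha>_def by (rule restrict_apply')

lemma iota_apply: "f \<in> Bc \<Longrightarrow> \<iota> f = f"
  unfolding \<iota>_def by (rule restrict_apply')

lemma mult_H:
  "\<iota> \<otimes>\<^bsub>AutH\<^esub> \<iota> = \<iota>" "\<iota> \<otimes>\<^bsub>AutH\<^esub> \<alpha> = \<alpha>"
  "\<alpha> \<otimes>\<^bsub>AutH\<^esub> \<iota> = \<alpha>" "\<alpha> \<otimes>\<^bsub>AutH\<^esub> \<alpha> = \<iota>"
  and Bij_H: "\<iota> \<in> Bij Bc" "\<alpha> \<in> Bij Bc"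
proof -
  show i: "\<iota> \<in> Bij Bc" unfolding \<iota>_def by (rule id_Bij)
  have "bij_betw \<alpha> Bc Bc"
    by (rule bij_betwI[of _ _ _ \<alpha>])
      (auto simp only: alpha_apply conj_u_closed conj_u_conj_u Pi_iff)
  then show a: "\<alpha> \<in> Bij Bc" by (simp add: Bij_def \<alpha>_def)
  have "compose Bc \<alpha> \<alpha> = \<iota>"
    unfolding compose_def \<iota>_def
    by (rule restrict_ext) (simp only: alpha_apply conj_u_closed conj_u_conj_u)
  moreover have "compose Bc \<iota> f = f" "compose Bc f \<iota> = f" if "f \<in> Bij Bc" for f
    using that Bij_imp_extensional[OF that] Bij_imp_funcset[OF that] unfolding \<iota>_def
    by (simp_all add: Id_compose compose_Id)
  ultimately show "\<iota> \<otimes>\<^bsub>AutH\<^esub> \<iota> = \<iota>" "\<iota> \<otimes>\<^bsub>AutH\<^esub> \<alpha> = \<alpha>"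
    "\<alpha> \<otimes>\<^bsub>AutH\<^esub> \<iota> = \<alpha>" "\<alpha> \<otimes>\<^bsub>AutH\<^esub> \<alpha> = \<iota>"
    using i a by (simp_all add: alg_aut_group_def BijGroup_def)
qed

lemma one_AutH: "\<one>\<^bsub>alg_aut_group B\<^esub> = \<iota>"
  by (simp add: alg_aut_group_def BijGroup_def \<iota>_def)

lemma H_alg_iso: "H \<subseteq> alg_iso B B"
proof -
  have b: "bij_betw \<iota> Bc Bc" "bij_betw \<alpha> Bc Bc" using Bij_H by (auto simp: Bij_def)
  have cj: "conj_u (f \<circ> g) = conj_u f \<circ> conj_u g" "conj_u (\<lambda>x. f x + g x) = (\<lambda>x. conj_u f x + conj_u g x)"
    "conj_u (\<lambda>x. s c (f x)) = (\<lambda>x. s c (conj_u f x))" "conj_u id = id" for f g c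
    by (auto simp: conj_u_def fun_eq_iff uu u_rules)
  have "\<iota> \<in> alg_iso B B"
    unfolding alg_iso_def ring_iso_def
    using b B_closed by (auto intro!: ring_hom_memI simp: iota_apply)
  moreover have "\<alpha> \<in> alg_iso B B"
    unfolding alg_iso_def ring_iso_def
    using b B_closed conj_u_closed
    by (auto intro!: ring_hom_memI simp: alpha_apply cj)
  ultimately show ?thesis by (simp add: H_def)
qed

lemma subgroup_H: "subgroup H (alg_aut_group B)"
proof -
  let ?G = "alg_aut_group B"
  have sub: "H \<subseteq> carrier ?G"
    using H_alg_iso Bij_H by (auto simp: alg_aut_group_def H_def)
  have mult: "x \<otimes>\<^bsub>?G\<^esub> y \<in> H" if "x \<in> H" "y \<in> H" for x y
    using that mult_H by (auto simp: H_def)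
  have "inv\<^bsub>?G\<^esub> x = x" if x: "x \<in> H" for x
    unfolding m_inv_def
  proof (rule the_equality)
    show xx: "x \<in> carrier ?G \<and> x \<otimes>\<^bsub>?G\<^esub> x = \<one>\<^bsub>?G\<^esub> \<and> x \<otimes>\<^bsub>?G\<^esub> x = \<one>\<^bsub>?G\<^esub>"
      using x sub mult_H unfolding one_AutH by (auto simp: H_def)
    fix y assume y: "y \<in> carrier ?G \<and> x \<otimes>\<^bsub>?G\<^esub> y = \<one>\<^bsub>?G\<^esub> \<and> y \<otimes>\<^bsub>?G\<^esub> x = \<one>\<^bsub>?G\<^esub>"
    \<comment> \<open>Uniqueness of the inverse is borrowed from the group of all bijections of
      \<open>Bc\<close>, which has the same multiplication and unit.\<close>
    interpret Bij: group "BijGroup Bc" by (rule group_BijGroup)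
    have [simp]: "mult ?G = mult (BijGroup Bc)" "one ?G = one (BijGroup Bc)"
      by (simp_all add: alg_aut_group_def)
    have "x \<in> carrier (BijGroup Bc)" "y \<in> carrier (BijGroup Bc)"
      using xx y by (auto simp: alg_aut_group_def BijGroup_def)
    then show "y = x" using xx y Bij.inv_equality by auto
  qed
  then show ?thesis
    using sub mult by (intro subgroup.intro) (auto simp: one_AutH H_def)
qed

lemma linear_funs: "vector_space (\<lambda>c (f :: 'a \<Rightarrow> 't) x. s c (f x))"
  by unfold_locales (auto simp: fun_eq_iff algebra_simps)

lemma alg_dim_A: "alg_dim A = 2 * alg_dim B"
proof -
  interpret F: vector_space "\<lambda>c (f :: 't \<Rightarrow> 't) x. s c (f x)" by (rule linear_funs)
  let ?sc = "\<lambda>c (f :: 't \<Rightarrow> 't) x. s c (f x)"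
  define r where "r f = f \<circ> u" for f :: "'t \<Rightarrow> 't"
  have lr: "Vector_Spaces.linear ?sc ?sc r"
    by (simp add: Vector_Spaces.linear_iff linear_funs r_def fun_eq_iff)
  interpret r: Vector_Spaces.linear ?sc ?sc r by (rule lr)
  have rr: "r (r f) = f" for f by (simp add: r_def fun_eq_iff uu)
  then have injr: "inj r" by (rule inj_on_inverseI[where g = r])
  have sB: "F.subspace Bc"
    unfolding F.subspace_def plus_fun_def zero_fun_def by (intro conjI ballI allI B_closed)
  have sA: "F.subspace Ac"
    unfolding F.subspace_def plus_fun_def zero_fun_def by (intro conjI ballI allI A_closed)
  obtain K where K: "K \<subseteq> Bc" "F.independent K" "Bc \<subseteq> F.span K" "card K = F.dim Bc"
    by (rule F.basis_exists)
  have spK: "F.span K = Bc" by (rule subset_antisym[OF F.span_minimal[OF K(1) sB] K(3)])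
  have spr: "F.span (r ` K) = r ` Bc" using r.span_image[of K] spK by simp
  have join: "join b c = b + r c" for b c by (simp add: join_def r_def fun_eq_iff)
  have zero: "0 \<in> Bc" using sB by (rule F.subspace_0)
  have disj: "F.span K \<inter> F.span (r ` K) = {0}"
  proof -
    \<comment> \<open>A common element \<open>f = r c\<close> has the two decompositions
      \<open>join f 0\<close> and \<open>join 0 c\<close>; comparing their symmetric parts gives
      \<open>f = 0\<close>.\<close>
    have "f = 0" if f: "f \<in> Bc" "f \<in> r ` Bc" for f
    proof -
      obtain c where c: "c \<in> Bc" "f = r c" using f by blast
      have "join f 0 = join 0 c" using c by (simp add: join)
      then show ?thesis using sym_part_join[OF f(1) zero] sym_part_join[OF zero c(1)] by simp
    qed
    moreover have "0 \<in> r ` Bc" using zero by (rule image_eqI[rotated]) (rule r.zero [symmetric])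
    ultimately show ?thesis unfolding spK spr using zero by blast
  qed
  have ind: "F.independent (K \<union> r ` K)"
    by (rule independent_Un_disjoint_span[OF linear_funs K(2) _ disj])
      (rule r.independent_injective_image[OF K(2) inj_on_subset[OF injr subset_UNIV]])
  have rA: "r c \<in> Ac" if "c \<in> Bc" for c
    using join_closed[OF zero that] by (simp add: join)
  have dA: "card (K \<union> r ` K) = F.dim Ac"
  proof (rule F.basis_card_eq_dim[OF _ _ ind])
    show "K \<union> r ` K \<subseteq> Ac" using K(1) B_subset_A rA by blast
    show "Ac \<subseteq> F.span (K \<union> r ` K)"
    proof
      fix f assume f: "f \<in> Ac"
      have "f = sym_part f + r (alt_part f)" by (simp only: join [symmetric] join_parts)
      moreover have "sym_part f \<in> F.span K" "r (alt_part f) \<in> F.span (r ` K)"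
        unfolding spK spr by (rule sym_part_closed[OF f], rule imageI, rule alt_part_closed[OF f])
      ultimately show "f \<in> F.span (K \<union> r ` K)" unfolding F.span_Un by blast
    qed
  qed
  have disjK: "K \<inter> r ` K = {}"
  proof -
    have "0 \<notin> K" using K(2) F.dependent_zero by metis
    moreover have "K \<inter> r ` K \<subseteq> F.span K \<inter> F.span (r ` K)"
      by (intro Int_mono F.span_superset)
    ultimately show ?thesis unfolding disj subset_singleton_iff by force
  qed
  have cr: "card (r ` K) = card K" by (rule card_image[OF inj_on_subset[OF injr subset_UNIV]])
  have "card (K \<union> r ` K) = 2 * card K"
  \<comment> \<open>For infinite \<open>K\<close> both sides are 0, the value of \<open>card\<close>
    on infinite sets.\<close>
  proof (cases "finite K")
    case True
    then show ?thesis using card_Un_disjoint[OF True finite_imageI[OF True] disjK] cr by linarith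
  qed simp
  then show ?thesis by (simp only: alg_dim_def commutant_simps dA [symmetric] K(4))
qed

end

section \<open>Nontrivial conjugation and the crossed product isomorphism\<close>

locale outer_odd_involution = odd_involution s G0 G1 t u
  for s :: "complex \<Rightarrow> 't::ab_group_add \<Rightarrow> 't" and G0 G1 t u +
  assumes outer: "\<exists>f\<in>Bc. u \<circ> f \<noteq> f \<circ> u"
begin

text \<open>If conjugation by \<open>u\<close> fixed the small algebra pointwise, \<open>u\<close>
  would commute with all of it, against \<open>outer\<close>. Hence \<open>H\<close> has two
  elements and does not collapse to one.\<close>

lemma iota_ne_alpha: "\<iota> \<noteq> \<alpha>"
proof
  assume eq: "\<iota> = \<alpha>"
  have "u \<circ> f = f \<circ> u" if f: "f \<in> Bc" for f
  proof
    fix x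
    have "f = conj_u f" using eq f by (metis alpha_apply iota_apply)
    then have "f (u x) = u (f (u (u x)))" by (metis conj_u_def)
    then show "(u \<circ> f) x = (f \<circ> u) x" by (simp add: uu)
  qed
  then show False using outer by blast
qed

lemma H_iso: "AutH \<cong> integer_mod_group 2"
proof -
  define h where "h g = (if g = \<iota> then 0 else 1 :: int)" for g
  have "h \<in> iso AutH (integer_mod_group 2)"
  proof (rule isoI)
    show "h \<in> hom AutH (integer_mod_group 2)"
      using mult_H iota_ne_alpha by (intro homI) (auto simp: h_def H_def carrier_integer_mod_group)
    have "{0..<2::int} = {0,1}" by auto
    then show "bij_betw h (carrier AutH) (carrier (integer_mod_group 2))"
      using iota_ne_alpha by (auto simp: bij_betw_def inj_on_def h_def H_def carrier_integer_mod_group)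
  qed
  then show ?thesis by (auto simp: is_iso_def)
qed

text \<open>The element \<open>b + c \<circ> u\<close> is sent to the formal sum of \<open>b\<close>
  at \<open>\<iota>\<close> and \<open>c\<close> at \<open>\<alpha>\<close>, so that
  \<open>u\<close> itself corresponds to the group element \<open>\<alpha>\<close>.\<close>

definition \<Phi> :: "('t \<Rightarrow> 't) \<Rightarrow> (('t \<Rightarrow> 't) \<Rightarrow> ('t \<Rightarrow> 't)) \<Rightarrow> 't \<Rightarrow> 't" where
  "\<Phi> f = (\<lambda>g\<in>H. if g = \<iota> then sym_part f else alt_part f)"

lemma Phi_simps: "\<Phi> f \<iota> = sym_part f" "\<Phi> f \<alpha> = alt_part f"
  using iota_ne_alpha by (auto simp: \<Phi>_def H_def)

lemma Phi_eqI:
  assumes "a \<in> extensional H" "a \<iota> = sym_part f" "a \<alpha> = alt_part f"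
  shows "\<Phi> f = a"
  by (rule extensionalityI[of _ H]) (use assms Phi_simps in \<open>auto simp: \<Phi>_def H_def\<close>)

lemma Phi_join:
  assumes "b \<in> Bc" "c \<in> Bc"
  shows "\<Phi> (join b c) = (\<lambda>g\<in>H. if g = \<iota> then b else c)"
  unfolding \<Phi>_def by (simp only: sym_part_join[OF assms] alt_part_join[OF assms])

text \<open>In a group of order two each element is a product in exactly two ways, so every
  coefficient is a sum of two terms.\<close>

lemma crossed_product_mult:
  assumes a: "a \<in> H \<rightarrow>\<^sub>E Bc" and b: "b \<in> H \<rightarrow>\<^sub>E Bc"
  shows "a \<otimes>\<^bsub>crossed_product B AutH\<^esub> b = (\<lambda>g\<in>H. if g = \<iota>
    then (\<lambda>x. a \<iota> (b \<iota> x) + a \<alpha> (conj_u (b \<alpha>) x)) else (\<lambda>x. a \<iota> (b \<alpha> x) + a \<alpha> (conj_u (b \<iota>) x)))"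
proof -
  have cl: "a \<iota> \<in> Bc" "a \<alpha> \<in> Bc" "b \<iota> \<in> Bc" "b \<alpha> \<in> Bc" using a b by (auto simp: H_def)
  interpret B: ring B by (rule ring_commutant[OF vs linG])
  have sets: "{(g1, g2) \<in> H \<times> H. g1 \<otimes>\<^bsub>AutH\<^esub> g2 = \<iota>} = {(\<iota>, \<iota>), (\<alpha>, \<alpha>)}"
    "{(g1, g2) \<in> H \<times> H. g1 \<otimes>\<^bsub>AutH\<^esub> g2 = \<alpha>} = {(\<iota>, \<alpha>), (\<alpha>, \<iota>)}"
    using mult_H iota_ne_alpha by (auto simp: H_def)
  let ?t = "\<lambda>p. a (fst p) \<otimes>\<^bsub>B\<^esub> (fst p) (b (snd p))"
  have t: "?t (\<iota>, \<iota>) \<in> Bc" "?t (\<alpha>, \<alpha>) \<in> Bc" "?t (\<iota>, \<alpha>) \<in> Bc" "?t (\<alpha>, \<iota>) \<in> Bc"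
    unfolding fst_conv snd_conv using cl
    by (simp_all only: iota_apply alpha_apply conj_u_closed B.m_closed)
  have two: "finsum B ?t {p, q} = ?t p \<oplus>\<^bsub>B\<^esub> ?t q" if "p \<noteq> q" "?t p \<in> Bc" "?t q \<in> Bc" for p q
    using that by (subst B.finsum_insert) auto
  have s1: "finsum B ?t {(\<iota>, \<iota>), (\<alpha>, \<alpha>)} = (\<lambda>x. a \<iota> (b \<iota> x) + a \<alpha> (conj_u (b \<alpha>) x))"
    using two[of "(\<iota>, \<iota>)" "(\<alpha>, \<alpha>)"] t iota_ne_alpha cl by (simp add: alpha_apply iota_apply)
  have s2: "finsum B ?t {(\<iota>, \<alpha>), (\<alpha>, \<iota>)} = (\<lambda>x. a \<iota> (b \<alpha> x) + a \<alpha> (conj_u (b \<iota>) x))"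
    using two[of "(\<iota>, \<alpha>)" "(\<alpha>, \<iota>)"] t iota_ne_alpha cl by (simp add: alpha_apply iota_apply)
  have "a \<otimes>\<^bsub>crossed_product B AutH\<^esub> b =
      (\<lambda>g\<in>H. finsum B ?t {(g1, g2) \<in> H \<times> H. g1 \<otimes>\<^bsub>AutH\<^esub> g2 = g})"
    by (simp add: crossed_product_def)
  also have "\<dots> = (\<lambda>g\<in>H. if g = \<iota>
    then (\<lambda>x. a \<iota> (b \<iota> x) + a \<alpha> (conj_u (b \<alpha>) x)) else (\<lambda>x. a \<iota> (b \<alpha> x) + a \<alpha> (conj_u (b \<iota>) x)))"
  proof (rule restrict_ext)
    fix g assume "g \<in> H"
    then consider "g = \<iota>" | "g = \<alpha>" by (auto simp: H_def)
    then show "finsum B ?t {(g1, g2) \<in> H \<times> H. g1 \<otimes>\<^bsub>AutH\<^esub> g2 = g} = (if g = \<iota>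
      then (\<lambda>x. a \<iota> (b \<iota> x) + a \<alpha> (conj_u (b \<alpha>) x)) else (\<lambda>x. a \<iota> (b \<alpha> x) + a \<alpha> (conj_u (b \<iota>) x)))"
    proof cases
      case 1
      show ?thesis unfolding 1 sets(1) s1 by (simp only: simp_thms if_True)
    next
      case 2
      show ?thesis unfolding 2 sets(2) s2 by (simp only: iota_ne_alpha [symmetric] simp_thms if_False)
    qed
  qed
  finally show ?thesis .
qed

text \<open>The inverse map is \<open>join\<close>, by existence and uniqueness of the
  decomposition. Multiplicativity is the agreement of \<open>join_mult\<close> with
  \<open>crossed_product_mult\<close>.\<close>

lemma Phi_alg_iso: "\<Phi> \<in> alg_iso A (crossed_product B AutH)"
proof -
  let ?X = "crossed_product B AutH"
  have car: "carrier ?X = H \<rightarrow>\<^sub>E Bc" by (simp add: crossed_product_def)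
  have closed: "\<Phi> f \<in> H \<rightarrow>\<^sub>E Bc" if "f \<in> Ac" for f
    unfolding \<Phi>_def using sym_part_closed[OF that] alt_part_closed[OF that] by auto
  have bij: "bij_betw \<Phi> (carrier A) (carrier ?X)"
    unfolding car
  proof (rule bij_betwI[of _ _ _ "\<lambda>a. join (a \<iota>) (a \<alpha>)"])
    show "\<Phi> \<in> Ac \<rightarrow> H \<rightarrow>\<^sub>E Bc" using closed by blast
    show "(\<lambda>a. join (a \<iota>) (a \<alpha>)) \<in> (H \<rightarrow>\<^sub>E Bc) \<rightarrow> Ac"
      by (rule funcsetI, rule join_closed) (auto simp: H_def)
    show "join (\<Phi> f \<iota>) (\<Phi> f \<alpha>) = f" for f by (simp add: Phi_simps join_parts)
    show "\<Phi> (join (a \<iota>) (a \<alpha>)) = a" if "a \<in> H \<rightarrow>\<^sub>E Bc" for a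
    proof -
      have "a \<iota> \<in> Bc" "a \<alpha> \<in> Bc" using that by (auto simp: H_def)
      then show ?thesis
        using that by (intro Phi_eqI) (simp_all add: sym_part_join alt_part_join PiE_iff)
    qed
  qed
  have "\<Phi> \<in> ring_hom A ?X"
  proof (rule ring_hom_memI)
    show "\<Phi> f \<in> carrier ?X" if "f \<in> carrier A" for f using closed[OF that] car by simp
    fix f g assume f: "f \<in> carrier A" and g: "g \<in> carrier A"
    note cl = sym_part_closed[OF f] alt_part_closed[OF f] sym_part_closed[OF g] alt_part_closed[OF g]
    have comp: "(\<lambda>x. b (c x)) \<in> Bc" if "b \<in> Bc" "c \<in> Bc" for b c
      using B_closed(4)[OF that] by (simp add: o_def)
    have "f \<circ> g = join (sym_part f) (alt_part f) \<circ> join (sym_part g) (alt_part g)" by (simp only: join_parts)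
    also have "\<dots> = join (\<lambda>x. sym_part f (sym_part g x) + alt_part f (conj_u (alt_part g) x)) (\<lambda>x. sym_part f (alt_part g x) + alt_part f (conj_u (sym_part g) x))"
      by (rule join_mult[OF cl])
    finally have "\<Phi> (f \<circ> g) = (\<lambda>h\<in>H. if h = \<iota>
        then (\<lambda>x. sym_part f (sym_part g x) + alt_part f (conj_u (alt_part g) x)) else (\<lambda>x. sym_part f (alt_part g x) + alt_part f (conj_u (sym_part g) x)))"
      by (simp only: Phi_join[OF B_closed(3)[OF comp comp] B_closed(3)[OF comp comp]] cl conj_u_closed)
    then show "\<Phi> (f \<otimes>\<^bsub>A\<^esub> g) = \<Phi> f \<otimes>\<^bsub>?X\<^esub> \<Phi> g"
      using crossed_product_mult[OF closed[OF f] closed[OF g]]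
      by (simp only: commutant_simps(1) Phi_simps)
    show "\<Phi> (f \<oplus>\<^bsub>A\<^esub> g) = \<Phi> f \<oplus>\<^bsub>?X\<^esub> \<Phi> g"
    proof (rule Phi_eqI)
      show "(\<Phi> f \<oplus>\<^bsub>?X\<^esub> \<Phi> g) \<iota> = sym_part (f \<oplus>\<^bsub>A\<^esub> g)" "(\<Phi> f \<oplus>\<^bsub>?X\<^esub> \<Phi> g) \<alpha> = alt_part (f \<oplus>\<^bsub>A\<^esub> g)"
        by (simp_all add: crossed_product_def Phi_simps H_def)
          (simp_all add: sym_part_def alt_part_def fun_eq_iff t_rules algebra_simps)
    qed (simp add: crossed_product_def)
  next
    have "join id (\<lambda>x. 0) = id" by (auto simp: join_def)
    then have "\<Phi> id = (\<lambda>g\<in>H. if g = \<iota> then id else (\<lambda>x. 0))"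
      using Phi_join[OF B_closed(2,1)] by simp
    then show "\<Phi> \<one>\<^bsub>A\<^esub> = \<one>\<^bsub>?X\<^esub>"
      by (simp add: crossed_product_def one_AutH cong: if_cong)
  qed
  moreover have "\<Phi> (c \<odot>\<^bsub>A\<^esub> f) = c \<odot>\<^bsub>?X\<^esub> \<Phi> f" for c f
  proof (rule Phi_eqI)
    show "(c \<odot>\<^bsub>?X\<^esub> \<Phi> f) \<iota> = sym_part (c \<odot>\<^bsub>A\<^esub> f)" "(c \<odot>\<^bsub>?X\<^esub> \<Phi> f) \<alpha> = alt_part (c \<odot>\<^bsub>A\<^esub> f)"
      by (simp_all add: crossed_product_def Phi_simps H_def)
        (simp_all add: sym_part_def alt_part_def fun_eq_iff t_rules algebra_simps)
  qed (simp add: crossed_product_def)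
  ultimately show ?thesis using bij by (auto simp: alg_iso_def ring_iso_def)
qed

theorem crossed_product_decomposition:
  "(\<exists>H. subgroup H (alg_aut_group B) \<and> (alg_aut_group B)\<lparr>carrier := H\<rparr> \<cong> integer_mod_group 2 \<and>
      alg_iso A (crossed_product B ((alg_aut_group B)\<lparr>carrier := H\<rparr>)) \<noteq> {}) \<and>
    alg_dim A = 2 * alg_dim B"
  using subgroup_H H_iso Phi_alg_iso alg_dim_A by blast

end

section \<open>Inversions and signs\<close>

definition index_pairs :: "nat \<Rightarrow> (nat \<times> nat) set" where
  "index_pairs n = {(i, j). i \<in> {1..n} \<and> j \<in> {1..n} \<and> i < j}"

text \<open>A common form of two signs: constant weight -1 gives the sign of the permutation, and
  the weight -1 to the product of the two degrees gives \<open>perm_sign\<close>.\<close>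

definition inversion_prod ::
  "nat \<Rightarrow> (nat \<Rightarrow> nat) \<Rightarrow> (nat \<Rightarrow> nat \<Rightarrow> 'a::comm_monoid_mult) \<Rightarrow> 'a" where
  "inversion_prod n \<sigma> w = (\<Prod>(i, j)\<in>index_pairs n. if \<sigma> i > \<sigma> j then w i j else 1)"

lemma finite_index_pairs [simp]: "finite (index_pairs n)"
  by (rule finite_subset[of _ "{1..n} \<times> {1..n}"]) (auto simp: index_pairs_def)

text \<open>A symmetric \<open>g\<close> is a function of unordered pairs, and \<open>\<tau>\<close>
  permutes these. Sorting the image pair by \<open>?o\<close> turns this into a bijection of
  \<open>index_pairs n\<close>.\<close>

lemma prod_index_pairs_permute:
  fixes g :: "nat \<Rightarrow> nat \<Rightarrow> 'a::comm_monoid_mult"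
  assumes \<tau>: "\<tau> permutes {1..n}" and sym: "\<And>i j. g i j = g j i"
  shows "(\<Prod>(i, j)\<in>index_pairs n. g i j) = (\<Prod>(i, j)\<in>index_pairs n. g (\<tau> i) (\<tau> j))"
proof -
  let ?o = "\<lambda>i j. if i < j then (i, j) else (j, i :: nat)"
  let ?\<rho> = "Hilbert_Choice.inv \<tau>"
  have inv: "?\<rho> (\<tau> i) = i" "\<tau> (?\<rho> i) = i" for i using permutes_inverses[OF \<tau>] by auto
  have inj: "\<tau> i = \<tau> j \<longleftrightarrow> i = j" "?\<rho> i = ?\<rho> j \<longleftrightarrow> i = j" for i j by (metis inv)+
  have mem: "\<tau> i \<in> {1..n} \<longleftrightarrow> i \<in> {1..n}" "?\<rho> i \<in> {1..n} \<longleftrightarrow> i \<in> {1..n}" for i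
    using permutes_in_image[OF \<tau>] permutes_in_image[OF permutes_inv[OF \<tau>]] by auto
  show ?thesis
  proof (rule prod.reindex_bij_witness[of _ "\<lambda>(i, j). ?o (\<tau> i) (\<tau> j)" "\<lambda>(i, j). ?o (?\<rho> i) (?\<rho> j)"])
    fix p assume p: "p \<in> index_pairs n"
    obtain i j where ij: "p = (i, j)" by force
    have m: "i \<in> {1..n}" "j \<in> {1..n}" "i < j" using p ij by (auto simp: index_pairs_def)
    then have ne: "\<tau> i \<noteq> \<tau> j" "?\<rho> i \<noteq> ?\<rho> j" using inj by auto
    show "(case case p of (i, j) \<Rightarrow> ?o (?\<rho> i) (?\<rho> j) of (i, j) \<Rightarrow> ?o (\<tau> i) (\<tau> j)) = p"
      "(case case p of (i, j) \<Rightarrow> ?o (\<tau> i) (\<tau> j) of (i, j) \<Rightarrow> ?o (?\<rho> i) (?\<rho> j)) = p"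
      using m(3) ij by (auto simp: inv)
    show "(case p of (i, j) \<Rightarrow> ?o (?\<rho> i) (?\<rho> j)) \<in> index_pairs n"
      "(case p of (i, j) \<Rightarrow> ?o (\<tau> i) (\<tau> j)) \<in> index_pairs n"
      using m ne ij mem by (auto simp: index_pairs_def simp del: atLeastAtMost_iff)
    show "(case case p of (i, j) \<Rightarrow> ?o (?\<rho> i) (?\<rho> j) of (i, j) \<Rightarrow> g (\<tau> i) (\<tau> j)) = (case p of (i, j) \<Rightarrow> g i j)"
      using ij sym by (auto simp: inv)
  qed
qed

text \<open>A pair is inverted by the composition exactly when one, but not both, of the following
  holds: \<open>\<tau>\<close> inverts it, or \<open>\<sigma>\<close> inverts its sorted image under
  \<open>\<tau>\<close>. When both hold, the weight occurs twice and cancels.\<close>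

lemma inversion_prod_comp:
  fixes w :: "nat \<Rightarrow> nat \<Rightarrow> 'a::comm_monoid_mult"
  assumes \<sigma>: "\<sigma> permutes {1..n}" and \<tau>: "\<tau> permutes {1..n}"
    and sym: "\<And>i j. w i j = w j i" and sq: "\<And>i j. w i j * w i j = 1"
  shows "inversion_prod n (\<sigma> \<circ> \<tau>) w = inversion_prod n \<tau> w *
    inversion_prod n \<sigma> (\<lambda>i j. w (Hilbert_Choice.inv \<tau> i) (Hilbert_Choice.inv \<tau> j))"
proof -
  let ?\<rho> = "Hilbert_Choice.inv \<tau>"
  have inv: "?\<rho> (\<tau> i) = i" for i using permutes_inverses[OF \<tau>] by auto
  have inj\<sigma>: "\<sigma> i = \<sigma> j \<longleftrightarrow> i = j" for i j using permutes_inj[OF \<sigma>] by (auto dest: injD)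
  have inj\<tau>: "\<tau> i = \<tau> j \<longleftrightarrow> i = j" for i j using permutes_inj[OF \<tau>] by (auto dest: injD)
  \<comment> \<open>On ordered pairs the condition says that \<open>\<sigma>\<close> inverts the
    pair, but it is symmetric in \<open>i\<close> and \<open>j\<close>, as reindexing along
    \<open>\<tau>\<close> requires.\<close>
  define g where "g i j = (if (i < j) \<noteq> (\<sigma> i < \<sigma> j) then w (?\<rho> i) (?\<rho> j) else 1)" for i j
  have gsym: "g i j = g j i" for i j
    unfolding g_def using sym inj\<sigma>[of i j] by (cases i j rule: linorder_cases) auto
  have "inversion_prod n \<sigma> (\<lambda>i j. w (?\<rho> i) (?\<rho> j)) = (\<Prod>(i, j)\<in>index_pairs n. g i j)"
    unfolding inversion_prod_def g_def
  proof (intro prod.cong refl)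
    fix p assume "p \<in> index_pairs n"
    then obtain i j where "p = (i, j)" "i < j" "\<sigma> i \<noteq> \<sigma> j" using inj\<sigma> by (auto simp: index_pairs_def)
    then show "(case p of (i, j) \<Rightarrow> if \<sigma> j < \<sigma> i then w (?\<rho> i) (?\<rho> j) else 1) =
        (case p of (i, j) \<Rightarrow> if (i < j) \<noteq> (\<sigma> i < \<sigma> j) then w (?\<rho> i) (?\<rho> j) else 1)"
      by auto
  qed
  also have "\<dots> = (\<Prod>(i, j)\<in>index_pairs n. g (\<tau> i) (\<tau> j))"
    by (rule prod_index_pairs_permute[OF \<tau> gsym])
  finally show ?thesis
    unfolding inversion_prod_def
  proof (simp only: prod.distrib [symmetric], intro prod.cong refl)
    fix p assume "p \<in> index_pairs n"
    then obtain i j where p: "p = (i, j)" "i < j" "\<sigma> (\<tau> i) \<noteq> \<sigma> (\<tau> j)" "\<tau> i \<noteq> \<tau> j"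
      using inj\<sigma> inj\<tau> by (auto simp: index_pairs_def)
    then show "(case p of (i, j) \<Rightarrow> if (\<sigma> \<circ> \<tau>) j < (\<sigma> \<circ> \<tau>) i then w i j else 1) =
        (case p of (i, j) \<Rightarrow> if \<tau> j < \<tau> i then w i j else 1) * (case p of (i, j) \<Rightarrow> g (\<tau> i) (\<tau> j))"
      by (auto simp: g_def inv sq)
  qed
qed

text \<open>An adjacent transposition has exactly one inversion. Any other transposition is reached
  by conjugating with adjacent ones, whose two signs cancel.\<close>

lemma inversion_prod_transpose:
  assumes "a \<in> {1..n}" "b \<in> {1..n}" "a \<noteq> b"
  shows "inversion_prod n (transpose a b) (\<lambda>_ _. - 1) = (- 1 :: 'a::comm_ring_1)"
proof -
  let ?I = "\<lambda>\<sigma>. inversion_prod n \<sigma> (\<lambda>_ _. - 1) :: 'a"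
  have adj: "?I (transpose c (Suc c)) = - 1" if "c \<in> {1..n}" "Suc c \<in> {1..n}" for c
  proof -
    have "?I (transpose c (Suc c)) = (\<Prod>p\<in>index_pairs n. if p = (c, Suc c) then - 1 else 1)"
      unfolding inversion_prod_def
      by (rule prod.cong) (auto simp: index_pairs_def transpose_def split: if_splits)
    also have "\<dots> = - 1" using that by (subst prod.delta[OF finite_index_pairs]) (auto simp: index_pairs_def)
    finally show ?thesis .
  qed
  have less: "?I (transpose a b) = - 1" if "a \<ge> 1" "a < b" "b \<le> n" for a b
    using that(2,3)
  proof (induction b)
    case (Suc c)
    show ?case
    proof (cases "a = c")
      case True
      then show ?thesis using adj Suc that(1) by auto
    next
      case False
      then have ac: "a < c" using Suc by simp
      have p: "transpose c (Suc c) permutes {1..n}" "transpose a c permutes {1..n}"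
        using Suc.prems ac that(1) by (auto intro!: permutes_swap_id)
      have "transpose a (Suc c) = transpose c (Suc c) \<circ> (transpose a c \<circ> transpose c (Suc c))"
        using ac by (auto simp: fun_eq_iff transpose_def)
      then have "?I (transpose a (Suc c)) =
          ?I (transpose c (Suc c)) * ?I (transpose a c) * ?I (transpose c (Suc c))"
        using inversion_prod_comp[OF p(1) permutes_compose[OF p], of "\<lambda>_ _. - 1 :: 'a"]
          inversion_prod_comp[OF p(2) p(1), of "\<lambda>_ _. - 1 :: 'a"]
        by simp
      then show ?thesis using adj[of c] Suc ac that(1) by simp
    qed
  qed simp
  show ?thesis
    using less[of a b] less[of b a] assms by (cases a b rule: linorder_cases) (auto simp: transpose_commute)
qed

lemma inversion_prod_sign:
  assumes "\<sigma> permutes {1..n}"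
  shows "inversion_prod n \<sigma> (\<lambda>_ _. - 1) = (of_int (sign \<sigma>) :: 'a::comm_ring_1)"
  using assms finite_atLeastAtMost
proof (induction rule: permutes_induct)
  case id
  then show ?case by (auto simp: inversion_prod_def index_pairs_def intro!: prod.neutral)
next
  case (swap a b p)
  have t: "transpose a b permutes {1..n}" using swap by (intro permutes_swap_id) auto
  have "permutation p" using swap by (auto simp: permutation_permutes)
  then have "sign (transpose a b \<circ> p) = - sign p"
    using swap by (simp add: sign_compose permutation_swap_id sign_swap_id)
  moreover have "inversion_prod n (transpose a b \<circ> p) (\<lambda>_ _. - 1 :: 'a) =
      inversion_prod n p (\<lambda>_ _. - 1) * inversion_prod n (transpose a b) (\<lambda>_ _. - 1)"
    by (rule inversion_prod_comp[OF t]) (use swap in simp_all)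
  ultimately show ?case
    by (simp only: swap.IH inversion_prod_transpose[OF swap.hyps(1-3)]) simp
qed

lemma inversion_prod_cong:
  assumes "\<And>i j. i \<in> {1..n} \<Longrightarrow> j \<in> {1..n} \<Longrightarrow> w i j = w' i j"
  shows "inversion_prod n \<sigma> w = inversion_prod n \<sigma> w'"
  unfolding inversion_prod_def by (rule prod.cong) (use assms in \<open>auto simp: index_pairs_def\<close>)

text \<open>The index \<open>i\<close> is the smaller entry of \<open>n - i\<close> pairs. The
  product thus splits into one factor per tensor position, which a tensor product of operators can
  realize.\<close>

lemma prod_index_pairs_fst:
  "(\<Prod>(i, j)\<in>index_pairs n. f i) = (\<Prod>i\<in>{1..n}. f i ^ (n - i))"
  for f :: "nat \<Rightarrow> 'a::comm_monoid_mult"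
proof -
  have "index_pairs n = Sigma {1..n} (\<lambda>i. {i<..n})" by (auto simp: index_pairs_def)
  then show ?thesis by (simp add: prod.Sigma [symmetric])
qed

lemma perm_sign_inversion_prod:
  "perm_sign n V0 \<sigma> v = inversion_prod n \<sigma> (\<lambda>i j. (- 1) ^ (degree V0 (v i) * degree V0 (v j)))"
proof -
  have "{(i, j). i \<in> {1..n} \<and> j \<in> {1..n} \<and> i < j \<and> \<sigma> i > \<sigma> j} =
      {p \<in> index_pairs n. \<sigma> (fst p) > \<sigma> (snd p)}"
    by (auto simp: index_pairs_def)
  then show ?thesis
    unfolding perm_sign_def inversion_prod_def
    by (simp add: prod.inter_filter case_prod_beta)
qed

lemma perm_sign_comp:
  assumes "\<sigma> permutes {1..n}" "\<tau> permutes {1..n}"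
  shows "perm_sign n V0 (\<sigma> \<circ> \<tau>) v =
    perm_sign n V0 \<tau> v * perm_sign n V0 \<sigma> (v \<circ> Hilbert_Choice.inv \<tau>)"
  unfolding perm_sign_inversion_prod o_def[of v]
  by (rule inversion_prod_comp[OF assms]) (simp_all add: mult.commute flip: power_add)

text \<open>This is the sign rule for moving the odd operator \<open>\<theta> \<otimes> \<dots> \<otimes> \<theta>\<close> past a permutation; the product
  over pairs of \<open>(-1)^d i\<close> is the Koszul sign of applying it to a tensor with degrees \<open>d\<close>.\<close>

lemma odd_shift_sign:
  fixes d :: "nat \<Rightarrow> nat"
  assumes \<sigma>: "\<sigma> permutes {1..n}" and d: "\<And>i. i \<in> {1..n} \<Longrightarrow> d i \<in> {0, 1}"
  shows "(\<Prod>(i, j)\<in>index_pairs n. (- 1) ^ d i) * inversion_prod n \<sigma> (\<lambda>i j. (- 1) ^ ((1 - d i) * (1 - d j))) =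
    of_int (sign \<sigma>) * inversion_prod n \<sigma> (\<lambda>i j. (- 1) ^ (d i * d j)) *
    (\<Prod>(i, j)\<in>index_pairs n. (- 1 :: 'a::comm_ring_1) ^ d (Hilbert_Choice.inv \<sigma> i))"
proof -
  let ?\<rho> = "Hilbert_Choice.inv \<sigma>"
  have inv: "?\<rho> (\<sigma> i) = i" for i using permutes_inverses[OF \<sigma>] by auto
  \<comment> \<open>Taking the minimum makes the factor symmetric, so the last product can be
    reindexed along \<open>\<sigma>\<close>. The identity then holds pair by pair: on an inverted
    pair the minimum selects \<open>d j\<close>, and the exponents
    \<open>d i + (1 - d i) * (1 - d j)\<close> and \<open>1 + d i * d j + d j\<close> have the same
    parity.\<close>
  define g where "g i j = (- 1 :: 'a) ^ d (?\<rho> (min i j))" for i j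
  have "(\<Prod>(i, j)\<in>index_pairs n. (- 1 :: 'a) ^ d (?\<rho> i)) = (\<Prod>(i, j)\<in>index_pairs n. g i j)"
    by (rule prod.cong) (auto simp: g_def index_pairs_def)
  also have "\<dots> = (\<Prod>(i, j)\<in>index_pairs n. g (\<sigma> i) (\<sigma> j))"
    by (rule prod_index_pairs_permute[OF \<sigma>]) (simp add: g_def min.commute)
  finally show ?thesis
    unfolding inversion_prod_sign[OF \<sigma>, symmetric] inversion_prod_def
  proof (simp only: prod.distrib [symmetric], intro prod.cong refl)
    fix p assume "p \<in> index_pairs n"
    then obtain i j where p: "p = (i, j)" "i < j" "d i \<in> {0, 1}" "d j \<in> {0, 1}"
      using d by (auto simp: index_pairs_def)
    then show "(case p of (i, j) \<Rightarrow> (- 1) ^ d i) *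
        (case p of (i, j) \<Rightarrow> if \<sigma> j < \<sigma> i then (- 1) ^ ((1 - d i) * (1 - d j)) else 1) =
      (case p of (i, j) \<Rightarrow> if \<sigma> j < \<sigma> i then - 1 else 1) *
        (case p of (i, j) \<Rightarrow> if \<sigma> j < \<sigma> i then (- 1) ^ (d i * d j) else 1) *
        (case p of (i, j) \<Rightarrow> g (\<sigma> i) (\<sigma> j))"
      by (auto simp: g_def inv min_def)
  qed
qed

section \<open>Operators on tensor powers\<close>

text \<open>A bijection between bases of \<open>V0\<close> and \<open>V1\<close> extends to mutually
  inverse maps \<open>f\<close> and \<open>g\<close> between the two subspaces. The projections glue
  them into one map, equal to \<open>f\<close> on \<open>V0\<close> and to \<open>g\<close> on
  \<open>V1\<close>.\<close>

lemma z2_graded_odd_involution: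
  assumes V: "z2_graded sV V0 V1"
    and dims: "vector_space.dim sV V0 = k" "vector_space.dim sV V1 = k" "k \<ge> 1"
  obtains \<theta> where "Vector_Spaces.linear sV sV \<theta>"
    "\<And>x. x \<in> V0 \<Longrightarrow> \<theta> x \<in> V1 \<and> \<theta> (\<theta> x) = x" "\<And>x. x \<in> V1 \<Longrightarrow> \<theta> x \<in> V0 \<and> \<theta> (\<theta> x) = x"
proof -
  interpret vector_space sV using V by (simp add: z2_graded_def)
  interpret vector_space_pair sV sV ..
  have s: "subspace V0" "subspace V1" using V by (auto simp: z2_graded_def)
  obtain p0 p1 where p: "Vector_Spaces.linear sV sV p0" "Vector_Spaces.linear sV sV p1"
    and p0: "\<And>x. x \<in> V0 \<Longrightarrow> p0 x = x \<and> p1 x = 0" and p1: "\<And>x. x \<in> V1 \<Longrightarrow> p0 x = 0 \<and> p1 x = x"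
    by (rule graded_projections[OF V]) blast
  obtain A where A: "A \<subseteq> V0" "independent A" "V0 \<subseteq> span A" "card A = k"
    using basis_exists[of V0] dims(1) by metis
  obtain B where B: "B \<subseteq> V1" "independent B" "V1 \<subseteq> span B" "card B = k"
    using basis_exists[of V1] dims(2) by metis
  \<comment> \<open>An infinite basis would have \<open>card\<close> 0, which
    \<open>k \<ge> 1\<close> excludes.\<close>
  have "finite A" "finite B" using A(4) B(4) dims(3) card.infinite by fastforce+
  then obtain \<beta> where \<beta>: "bij_betw \<beta> A B" using finite_same_card_bij A(4) B(4) by metis
  let ?\<gamma> = "inv_into A \<beta>"
  have b: "\<beta> x \<in> B" "?\<gamma> (\<beta> x) = x" if "x \<in> A" for x
    using \<beta> that by (auto simp: bij_betw_def)
  have c: "?\<gamma> x \<in> A" "\<beta> (?\<gamma> x) = x" if "x \<in> B" for x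
    using \<beta> that by (auto simp: bij_betw_def inv_into_into f_inv_into_f)
  obtain f where f: "Vector_Spaces.linear sV sV f" "\<forall>x\<in>A. f x = \<beta> x"
    using linear_independent_extend[OF A(2), of \<beta>] by blast
  obtain g where g: "Vector_Spaces.linear sV sV g" "\<forall>x\<in>B. g x = ?\<gamma> x"
    using linear_independent_extend[OF B(2), of ?\<gamma>] by blast
  interpret f: Vector_Spaces.linear sV sV f by fact
  interpret g: Vector_Spaces.linear sV sV g by fact
  have gf: "Vector_Spaces.linear sV sV (\<lambda>x. g (f x))" "Vector_Spaces.linear sV sV (\<lambda>x. f (g x))"
    "Vector_Spaces.linear sV sV (\<lambda>x. x)"
    using Vector_Spaces.linear_compose[OF f(1) g(1)] Vector_Spaces.linear_compose[OF g(1) f(1)]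
    by (simp_all add: o_def linear_ident)
  have f0: "f x \<in> V1 \<and> g (f x) = x" if "x \<in> V0" for x
  proof
    have x: "x \<in> span A" using that A by blast
    have "f ` span A \<subseteq> V1"
      unfolding f.span_image [symmetric] by (rule span_minimal) (use f(2) b B(1) s in auto)
    then show "f x \<in> V1" using x by blast
    show "g (f x) = x" by (rule linear_eq_on[OF gf(1,3) x]) (use f(2) g(2) b in auto)
  qed
  have g0: "g x \<in> V0 \<and> f (g x) = x" if "x \<in> V1" for x
  proof
    have x: "x \<in> span B" using that B by blast
    have "g ` span B \<subseteq> V0"
      unfolding g.span_image [symmetric] by (rule span_minimal) (use g(2) c A(1) s in auto)
    then show "g x \<in> V0" using x by blast
    show "f (g x) = x" by (rule linear_eq_on[OF gf(2,3) x]) (use f(2) g(2) c in auto)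
  qed
  show ?thesis
  proof (rule that[of "\<lambda>x. f (p0 x) + g (p1 x)"])
    show "Vector_Spaces.linear sV sV (\<lambda>x. f (p0 x) + g (p1 x))"
      using Vector_Spaces.linear_compose[OF p(1) f(1)] Vector_Spaces.linear_compose[OF p(2) g(1)]
      by (intro linear_compose_add) (simp_all add: o_def)
    show "f (p0 x) + g (p1 x) \<in> V1 \<and>
        f (p0 (f (p0 x) + g (p1 x))) + g (p1 (f (p0 x) + g (p1 x))) = x" if "x \<in> V0" for x
      using f0[OF that] p0[OF that] p1[of "f x"] by (simp add: g.zero f.zero)
    show "f (p0 x) + g (p1 x) \<in> V0 \<and>
        f (p0 (f (p0 x) + g (p1 x))) + g (p1 (f (p0 x) + g (p1 x))) = x" if "x \<in> V1" for x
      using g0[OF that] p1[OF that] p0[of "g x"] by (simp add: g.zero f.zero)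
  qed
qed

locale graded_tensor_power =
  fixes sV :: "complex \<Rightarrow> 'v::ab_group_add \<Rightarrow> 'v" and V0 V1 :: "'v set"
    and sT :: "complex \<Rightarrow> 't::ab_group_add \<Rightarrow> 't" and tens :: "(nat \<Rightarrow> 'v) \<Rightarrow> 't" and n :: nat
  assumes graded: "z2_graded sV V0 V1" and tensor_power: "tensor_power n sV sT tens"
begin

sublocale V: vector_space sV using tensor_power by (simp add: tensor_power_def)
sublocale T: vector_space sT using tensor_power by (simp add: tensor_power_def)
sublocale VV: vector_space_pair sV sV ..
sublocale TT: vector_space_pair sT sT ..

lemma multilinear_tens: "multilinear n sV sT tens"
  using tensor_power by (simp add: tensor_power_def)

definition homogeneous :: "(nat \<Rightarrow> 'v) \<Rightarrow> bool" where
  "homogeneous v \<longleftrightarrow> (\<forall>i\<in>{1..n}. v i \<in> V0 \<union> V1)"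

abbreviation \<phi> :: "(nat \<Rightarrow> nat) \<Rightarrow> 't \<Rightarrow> 't" where
  "\<phi> \<equiv> sign_action n V0 V1 sT tens"

lemma tens_cong: "(\<And>i. i \<in> {1..n} \<Longrightarrow> v i = w i) \<Longrightarrow> tens v = tens w"
  using multilinear_tens unfolding multilinear_def by blast

lemma tens_zero:
  assumes "i \<in> {1..n}" "v i = 0"
  shows "tens v = 0"
proof -
  interpret L: Vector_Spaces.linear sV sT "\<lambda>x. tens (v(i := x))"
    by (rule multilinearD[OF multilinear_tens assms(1)])
  show ?thesis using L.zero assms(2) by (metis fun_upd_triv)
qed

lemma tens_scale: "tens (\<lambda>i. sV (c i) (v i)) = sT (\<Prod>i\<in>{1..n}. c i) (tens v)"
proof -
  have "tens (\<lambda>i. if i \<in> I then sV (c i) (v i) else v i) = sT (\<Prod>i\<in>I. c i) (tens v)"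
    if "finite I" "I \<subseteq> {1..n}" for I
    using that
  proof (induction I)
    case (insert j I)
    let ?w = "\<lambda>i. if i \<in> I then sV (c i) (v i) else v i"
    have lin: "Vector_Spaces.linear sV sT (\<lambda>x. tens (?w(j := x)))"
      by (rule multilinearD[OF multilinear_tens]) (use insert in blast)
    have "(\<lambda>i. if i \<in> insert j I then sV (c i) (v i) else v i) = ?w(j := sV (c j) (v j))"
      by auto
    then have "tens (\<lambda>i. if i \<in> insert j I then sV (c i) (v i) else v i) =
        sT (c j) (tens (?w(j := v j)))"
      using linear_rules(2)[OF lin] by simp
    also have "?w(j := v j) = ?w" using insert by auto
    finally show ?case using insert by simp
  qed simp
  from this[of "{1..n}"] have "tens (\<lambda>i. if i \<in> {1..n} then sV (c i) (v i) else v i) = sT (\<Prod>i\<in>{1..n}. c i) (tens v)"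
    by simp
  moreover have "tens (\<lambda>i. if i \<in> {1..n} then sV (c i) (v i) else v i) = tens (\<lambda>i. sV (c i) (v i))"
    by (rule tens_cong) simp
  ultimately show ?thesis by simp
qed

text \<open>Functionals with value 1 at the factors multiply to a multilinear form. It factors
  through \<open>tens\<close> and takes the value 1 at \<open>v\<close>.\<close>

lemma tens_nonzero:
  assumes "\<And>i. i \<in> {1..n} \<Longrightarrow> v i \<noteq> 0"
  shows "tens v \<noteq> 0"
proof -
  interpret C: vector_space "(*) :: complex \<Rightarrow> complex \<Rightarrow> complex" by (rule vector_space_complex)
  have "\<exists>l. Vector_Spaces.linear sV (*) l \<and> l (v i) = (1::complex)" if "i \<in> {1..n}" for i
    using functional_exists[OF V.vector_space_axioms, of "v i" "{}"] assms[OF that] by auto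
  then obtain l where l: "Vector_Spaces.linear sV (*) (l i)" "l i (v i) = (1::complex)"
    if "i \<in> {1..n}" for i by metis
  define f where "f w = (\<Prod>i\<in>{1..n}. l i (w i))" for w
  have "multilinear n sV (*) f"
    unfolding multilinear_def
  proof (intro conjI allI impI ballI)
    show "f w = f w'" if "\<forall>i\<in>{1..n}. w i = w' i" for w w'
      unfolding f_def by (rule prod.cong) (use that in auto)
    fix w i assume i: "i \<in> {1..n}"
    have "f (w(i := x)) = l i x * (\<Prod>j\<in>{1..n} - {i}. l j (w j))" for x
      unfolding f_def using i by (simp add: prod.remove)
    then show "Vector_Spaces.linear sV (*) (\<lambda>x. f (w(i := x)))"
      unfolding Vector_Spaces.linear_iff
      by (simp only: linear_rules(1,2)[OF l(1)[OF i]] V.vector_space_axioms C.vector_space_axioms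
          distrib_right mult.assoc simp_thms)
  qed
  then obtain g where g: "Vector_Spaces.linear sT (*) g" "\<And>w. g (tens w) = f w"
    using tensor_power unfolding tensor_power_def by blast
  have "g (tens v) = 1" unfolding g(2) f_def by (rule prod.neutral) (use l in auto)
  then show ?thesis using linear_rules(3)[OF g(1)] by auto
qed

text \<open>Homogeneous vectors span the space and pure tensors span the tensor power, so operators
  may be compared on homogeneous pure tensors.\<close>

lemma linear_eqI:
  assumes f: "Vector_Spaces.linear sT sT f" and g: "Vector_Spaces.linear sT sT g"
    and eq: "\<And>v. homogeneous v \<Longrightarrow> f (tens v) = g (tens v)"
  shows "f = g"
proof
  fix x
  have "f (tens v) = g (tens v)" for v
    by (rule multilinear_eq_on_spanning[OF V.vector_space_axioms T.vector_space_axioms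
          z2_graded_span[OF graded] multilinear_compose[OF multilinear_tens f]
          multilinear_compose[OF multilinear_tens g]])
      (use eq in \<open>simp add: homogeneous_def\<close>)
  then show "f x = g x"
    by (intro TT.linear_eq_on[OF f g, of x "range tens"])
      (use tensor_power_span[OF tensor_power] in auto)
qed

lemma tensor_map:
  assumes F: "\<And>i. i \<in> {1..n} \<Longrightarrow> Vector_Spaces.linear sV sV (F i)"
  obtains f where "Vector_Spaces.linear sT sT f" "\<And>v. f (tens v) = tens (\<lambda>i. F i (v i))"
proof -
  have "multilinear n sV sT (\<lambda>v. tens (\<lambda>i. F i (v i)))"
    unfolding multilinear_def
  proof (intro conjI allI impI ballI)
    show "tens (\<lambda>i. F i (v i)) = tens (\<lambda>i. F i (w i))" if "\<forall>i\<in>{1..n}. v i = w i" for v w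
      by (rule tens_cong) (use that in simp)
    fix v i assume i: "i \<in> {1..n}"
    have "(\<lambda>j. F j ((v(i := x)) j)) = (\<lambda>j. F j (v j))(i := F i x)" for x by auto
    then show "Vector_Spaces.linear sV sT (\<lambda>x. tens (\<lambda>j. F j ((v(i := x)) j)))"
      using Vector_Spaces.linear_compose[OF F[OF i] multilinearD[OF multilinear_tens i]]
      by (simp add: o_def)
  qed
  then show ?thesis
    using tensor_power_universal[OF tensor_power T.vector_space_axioms] that by blast
qed

section \<open>The sign action as a homomorphism\<close>

lemma
  assumes "\<sigma> permutes {1..n}"
  shows linear_phi: "Vector_Spaces.linear sT sT (\<phi> \<sigma>)"
    and phi_tens: "homogeneous v \<Longrightarrow>
      \<phi> \<sigma> (tens v) = sT (perm_sign n V0 \<sigma> v) (tens (v \<circ> Hilbert_Choice.inv \<sigma>))"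
  using theI'[OF sign_action_ex1[OF graded tensor_power assms]]
  unfolding sign_action_def homogeneous_def by blast+

lemma homogeneous_permute:
  assumes "\<sigma> permutes {1..n}" "homogeneous v"
  shows "homogeneous (v \<circ> Hilbert_Choice.inv \<sigma>)"
  using assms permutes_in_image[OF permutes_inv[OF assms(1)]] by (auto simp: homogeneous_def)

lemma phi_comp:
  assumes \<sigma>: "\<sigma> permutes {1..n}" and \<tau>: "\<tau> permutes {1..n}"
  shows "\<phi> \<sigma> \<circ> \<phi> \<tau> = \<phi> (\<sigma> \<circ> \<tau>)"
proof (rule linear_eqI)
  have st: "\<sigma> \<circ> \<tau> permutes {1..n}" using permutes_compose[OF \<tau> \<sigma>] .
  show "Vector_Spaces.linear sT sT (\<phi> \<sigma> \<circ> \<phi> \<tau>)" "Vector_Spaces.linear sT sT (\<phi> (\<sigma> \<circ> \<tau>))"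
    using Vector_Spaces.linear_compose linear_phi \<sigma> \<tau> st by blast+
  fix v assume v: "homogeneous v"
  have "Hilbert_Choice.inv (\<sigma> \<circ> \<tau>) = Hilbert_Choice.inv \<tau> \<circ> Hilbert_Choice.inv \<sigma>"
    using \<sigma> \<tau> by (simp add: o_inv_distrib permutes_bij)
  then show "(\<phi> \<sigma> \<circ> \<phi> \<tau>) (tens v) = \<phi> (\<sigma> \<circ> \<tau>) (tens v)"
    using phi_tens[OF \<tau> v] phi_tens[OF st v] phi_tens[OF \<sigma> homogeneous_permute[OF \<tau> v]]
      linear_rules(2)[OF linear_phi[OF \<sigma>]]
    by (simp add: perm_sign_comp[OF \<sigma> \<tau>] o_assoc)
qed

lemma phi_id: "\<phi> id = id"
proof (rule linear_eqI)
  have id: "id permutes {1..n}" by (rule permutes_id)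
  show "Vector_Spaces.linear sT sT (\<phi> id)" by (rule linear_phi[OF id])
  show "Vector_Spaces.linear sT sT id" by (rule T.linear_id)
  have "inversion_prod n id w = 1" for w :: "nat \<Rightarrow> nat \<Rightarrow> complex"
    unfolding inversion_prod_def by (rule prod.neutral) (auto simp: index_pairs_def)
  then show "\<phi> id (tens v) = id (tens v)" if "homogeneous v" for v
    using phi_tens[OF id that] by (simp add: perm_sign_inversion_prod)
qed

section \<open>The odd operator, the even projection and a transposition\<close>

abbreviation "even_ops \<equiv> \<phi> ` {\<sigma>. \<sigma> permutes {1..n} \<and> evenperm \<sigma>}"
abbreviation "odd_ops \<equiv> \<phi> ` {\<sigma>. \<sigma> permutes {1..n} \<and> \<not> evenperm \<sigma>}"

text \<open>The operator is a tensor product of multiples of \<open>\<theta>\<close>, the multiple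
  depending on position and degree. \<open>K v\<close> stays abstract because the later argument
  needs only that a homogeneous tensor goes to a multiple of its image under
  \<open>\<theta>\<close>.\<close>

lemma odd_operator:
  assumes \<theta>: "Vector_Spaces.linear sV sV \<theta>"
    and \<theta>0: "\<And>x. x \<in> V0 \<Longrightarrow> \<theta> x \<in> V1 \<and> \<theta> (\<theta> x) = x"
    and \<theta>1: "\<And>x. x \<in> V1 \<Longrightarrow> \<theta> x \<in> V0 \<and> \<theta> (\<theta> x) = x"
  obtains u K where "Vector_Spaces.linear sT sT u" "\<And>x. u (u x) = x"
    "\<And>v. homogeneous v \<Longrightarrow> u (tens v) = sT (K v) (tens (\<theta> \<circ> v))"
    "\<And>\<sigma> x. \<sigma> permutes {1..n} \<Longrightarrow> u (\<phi> \<sigma> x) = sT (of_int (sign \<sigma>)) (\<phi> \<sigma> (u x))"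
proof -
  have inter: "V0 \<inter> V1 = {0}" using graded by (simp add: z2_graded_def)
  obtain p0 p1 where p: "Vector_Spaces.linear sV sV p0" "Vector_Spaces.linear sV sV p1"
    and p0: "\<And>x. x \<in> V0 \<Longrightarrow> p0 x = x \<and> p1 x = 0" and p1: "\<And>x. x \<in> V1 \<Longrightarrow> p0 x = 0 \<and> p1 x = x"
    by (rule graded_projections[OF graded]) blast
  note \<theta>_rules = linear_rules[OF \<theta>]
  \<comment> \<open>The exponent \<open>n - i\<close> gives the Koszul sign; powers of \<open>\<i>\<close> instead of \<open>\<plusminus>1\<close> make the square of
    each factor, hence of \<open>u\<close>, the identity.\<close>
  define \<Theta> where "\<Theta> i x = sV (\<i> ^ (n - i)) (\<theta> (p0 x)) + sV ((- \<i>) ^ (n - i)) (\<theta> (p1 x))" for i x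
  have \<Theta>: "Vector_Spaces.linear sV sV (\<Theta> i)" for i
    unfolding \<Theta>_def
    using Vector_Spaces.linear_compose[OF p(1) \<theta>] Vector_Spaces.linear_compose[OF p(2) \<theta>]
    by (intro VV.linear_compose_add VV.linear_compose_scale_right) (simp_all add: o_def)
  have \<Theta>V0: "\<Theta> i x = sV (\<i> ^ (n - i)) (\<theta> x)" if "x \<in> V0" for i x
    using p0[OF that] \<theta>_rules(3) by (simp add: \<Theta>_def)
  have \<Theta>V1: "\<Theta> i x = sV ((- \<i>) ^ (n - i)) (\<theta> x)" if "x \<in> V1" for i x
    using p1[OF that] \<theta>_rules(3) by (simp add: \<Theta>_def)
  have unit: "\<i> ^ m * (- \<i>) ^ m = 1" for m by (simp flip: power_mult_distrib)
  have \<Theta>\<Theta>: "\<Theta> i (\<Theta> i x) = x" if "x \<in> V0 \<union> V1" for i x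
    using that
  proof
    assume x: "x \<in> V0"
    then show ?thesis
      using \<theta>0[OF x] \<Theta>V1[of "\<theta> x"] linear_rules(2)[OF \<Theta>] by (simp add: \<Theta>V0 unit)
  next
    assume x: "x \<in> V1"
    then show ?thesis
      using \<theta>1[OF x] \<Theta>V0[of "\<theta> x"] linear_rules(2)[OF \<Theta>] by (simp add: \<Theta>V1 unit mult.commute)
  qed
  have \<Theta>hom: "\<Theta> i x = sV (\<i> ^ (n - i) * ((- 1) ^ degree V0 x) ^ (n - i)) (\<theta> x)"
    if "x \<in> V0 \<union> V1" for i x
  proof (cases "x \<in> V0")
    case True
    then show ?thesis by (simp add: \<Theta>V0 degree_def)
  next
    case False
    then show ?thesis using that by (simp add: \<Theta>V1 degree_def flip: power_mult_distrib)
  qed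
  obtain u where u: "Vector_Spaces.linear sT sT u" "\<And>v. u (tens v) = tens (\<lambda>i. \<Theta> i (v i))"
    by (rule tensor_map[of \<Theta>, OF \<Theta>]) blast
  \<comment> \<open>On a homogeneous tensor the scalars of the factors separate into
    \<open>c\<close>, common to all degrees, and the Koszul sign \<open>S d\<close>.\<close>
  define c where "c = (\<Prod>i\<in>{1..n}. \<i> ^ (n - i))"
  define S where "S d = (\<Prod>(i, j)\<in>index_pairs n. (- 1 :: complex) ^ d i)" for d :: "nat \<Rightarrow> nat"
  have u_hom: "u (tens v) = sT (c * S (\<lambda>i. degree V0 (v i))) (tens (\<theta> \<circ> v))" if v: "homogeneous v" for v
  proof -
    have "u (tens v) = tens (\<lambda>i. sV (\<i> ^ (n - i) * ((- 1) ^ degree V0 (v i)) ^ (n - i)) ((\<theta> \<circ> v) i))"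
      unfolding u(2) by (rule tens_cong) (use v \<Theta>hom in \<open>simp add: homogeneous_def\<close>)
    then show ?thesis
      unfolding tens_scale by (simp add: c_def S_def prod_index_pairs_fst prod.distrib o_def)
  qed
  have uu: "u \<circ> u = id"
  proof (rule linear_eqI)
    show "Vector_Spaces.linear sT sT (u \<circ> u)" by (rule Vector_Spaces.linear_compose[OF u(1) u(1)])
    show "Vector_Spaces.linear sT sT id" by (rule T.linear_id)
    show "(u \<circ> u) (tens v) = id (tens v)" if "homogeneous v" for v
      using tens_cong[of "\<lambda>i. \<Theta> i (\<Theta> i (v i))" v] that \<Theta>\<Theta> by (simp add: u(2) homogeneous_def)
  qed
  have comm: "u \<circ> \<phi> \<sigma> = (\<lambda>x. sT (of_int (sign \<sigma>)) (\<phi> \<sigma> (u x)))" if \<sigma>: "\<sigma> permutes {1..n}" for \<sigma>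
  proof (rule linear_eqI)
    let ?\<rho> = "Hilbert_Choice.inv \<sigma>"
    show "Vector_Spaces.linear sT sT (u \<circ> \<phi> \<sigma>)"
      by (rule Vector_Spaces.linear_compose[OF linear_phi[OF \<sigma>] u(1)])
    show "Vector_Spaces.linear sT sT (\<lambda>x. sT (of_int (sign \<sigma>)) (\<phi> \<sigma> (u x)))"
      using Vector_Spaces.linear_compose[OF u(1) linear_phi[OF \<sigma>]]
      by (intro TT.linear_compose_scale_right) (simp add: o_def)
    fix v assume v: "homogeneous v"
    show "(u \<circ> \<phi> \<sigma>) (tens v) = sT (of_int (sign \<sigma>)) (\<phi> \<sigma> (u (tens v)))"
    \<comment> \<open>The zero vector is split off because it has \<open>degree\<close> 0, which
      \<open>\<theta>\<close> does not change; for all other homogeneous vectors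
      \<open>\<theta>\<close> flips the degree.\<close>
    proof (cases "\<exists>i\<in>{1..n}. v i = 0")
      case True
      then have "tens v = 0" using tens_zero by blast
      then show ?thesis
        using linear_rules(3)[OF u(1)] linear_rules(3)[OF linear_phi[OF \<sigma>]] by simp
    next
      case False
      define d where "d = (\<lambda>i. degree V0 (v i))"
      have \<theta>v: "homogeneous (\<theta> \<circ> v)" using v \<theta>0 \<theta>1 by (auto simp: homogeneous_def)
      have d\<theta>: "degree V0 ((\<theta> \<circ> v) i) = 1 - d i" if i: "i \<in> {1..n}" for i
      proof (cases "v i \<in> V0")
        case True
        then have "\<theta> (v i) \<notin> V0"
          using \<theta>0[OF True] inter False i \<theta>_rules(3) by (metis IntI singletonD)
        then show ?thesis using True by (simp add: d_def degree_def)
      next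
        case False
        then have "\<theta> (v i) \<in> V0" using v i \<theta>1 by (auto simp: homogeneous_def)
        then show ?thesis using False by (simp add: d_def degree_def)
      qed
      have "perm_sign n V0 \<sigma> (\<theta> \<circ> v) = inversion_prod n \<sigma> (\<lambda>i j. (- 1) ^ ((1 - d i) * (1 - d j)))"
        unfolding perm_sign_inversion_prod by (rule inversion_prod_cong) (simp only: d\<theta>)
      moreover have "perm_sign n V0 \<sigma> v = inversion_prod n \<sigma> (\<lambda>i j. (- 1) ^ (d i * d j))"
        by (simp add: perm_sign_inversion_prod d_def)
      moreover have "d i \<in> {0, 1}" for i by (simp add: d_def degree_def)
      ultimately have sgn: "S d * perm_sign n V0 \<sigma> (\<theta> \<circ> v) =
          of_int (sign \<sigma>) * perm_sign n V0 \<sigma> v * S (d \<circ> ?\<rho>)"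
        using odd_shift_sign[OF \<sigma>, of d] by (simp add: S_def)
      have "\<phi> \<sigma> (u (tens v)) = sT (c * (S d * perm_sign n V0 \<sigma> (\<theta> \<circ> v))) (tens (\<theta> \<circ> v \<circ> ?\<rho>))"
        using linear_rules(2)[OF linear_phi[OF \<sigma>]] phi_tens[OF \<sigma> \<theta>v] u_hom[OF v]
        by (simp add: d_def mult.assoc)
      also have "\<dots> = sT (of_int (sign \<sigma>)) (sT (perm_sign n V0 \<sigma> v) (u (tens (v \<circ> ?\<rho>))))"
        unfolding sgn using u_hom[OF homogeneous_permute[OF \<sigma> v]]
        by (simp add: d_def o_def mult_ac)
      also have "\<dots> = sT (of_int (sign \<sigma>)) (u (\<phi> \<sigma> (tens v)))"
        by (simp add: phi_tens[OF \<sigma> v] linear_rules(2)[OF u(1)])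
      \<comment> \<open>The sign of \<open>\<sigma>\<close> squares to 1 and may be moved to the
        other side.\<close>
      finally show ?thesis by (simp flip: of_int_mult)
    qed
  qed
  show ?thesis
    by (rule that[of u "\<lambda>v. c * S (\<lambda>i. degree V0 (v i))"])
      (use u(1) uu comm u_hom in \<open>auto simp: fun_eq_iff\<close>)
qed

text \<open>\<open>P\<close> is the tensor power of the projection onto \<open>V0\<close>. It
  commutes with the action because permuting the factors of a tensor does not change whether all of
  them lie in \<open>V0\<close>.\<close>

lemma even_projection:
  obtains P where "P \<in> carrier (commutant sT (\<phi> ` {\<sigma>. \<sigma> permutes {1..n}}))"
    "\<And>v. (\<And>i. i \<in> {1..n} \<Longrightarrow> v i \<in> V0) \<Longrightarrow> P (tens v) = tens v"
    "\<And>v i. i \<in> {1..n} \<Longrightarrow> v i \<in> V1 \<Longrightarrow> P (tens v) = 0"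
proof -
  obtain p0 p1 where p: "Vector_Spaces.linear sV sV p0" "Vector_Spaces.linear sV sV p1"
    and p0: "\<And>x. x \<in> V0 \<Longrightarrow> p0 x = x \<and> p1 x = 0" and p1: "\<And>x. x \<in> V1 \<Longrightarrow> p0 x = 0 \<and> p1 x = x"
    by (rule graded_projections[OF graded]) blast
  obtain P where P: "Vector_Spaces.linear sT sT P" "\<And>v. P (tens v) = tens (\<lambda>i. p0 (v i))"
    by (rule tensor_map[of "\<lambda>_. p0", OF p(1)]) blast
  have Pe: "P (tens v) = tens v" if "\<And>i. i \<in> {1..n} \<Longrightarrow> v i \<in> V0" for v
    unfolding P(2) by (rule tens_cong) (use that p0 in blast)
  have Po: "P (tens v) = 0" if "i \<in> {1..n}" "v i \<in> V1" for v i
    unfolding P(2) by (rule tens_zero[OF that(1)]) (use that p1 in blast)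
  have "P \<circ> \<phi> \<sigma> = \<phi> \<sigma> \<circ> P" if \<sigma>: "\<sigma> permutes {1..n}" for \<sigma>
  proof (rule linear_eqI)
    show "Vector_Spaces.linear sT sT (P \<circ> \<phi> \<sigma>)" "Vector_Spaces.linear sT sT (\<phi> \<sigma> \<circ> P)"
      using Vector_Spaces.linear_compose P(1) linear_phi[OF \<sigma>] by blast+
    fix v assume v: "homogeneous v"
    have si: "Hilbert_Choice.inv \<sigma> i \<in> {1..n} \<longleftrightarrow> i \<in> {1..n}" "\<sigma> i \<in> {1..n} \<longleftrightarrow> i \<in> {1..n}" for i
      using permutes_in_image[OF permutes_inv[OF \<sigma>]] permutes_in_image[OF \<sigma>] by auto
    show "(P \<circ> \<phi> \<sigma>) (tens v) = (\<phi> \<sigma> \<circ> P) (tens v)"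
    proof (cases "\<forall>i\<in>{1..n}. v i \<in> V0")
      case True
      have "P (tens v) = tens v" by (rule Pe) (use True in blast)
      moreover have "P (tens (v \<circ> Hilbert_Choice.inv \<sigma>)) = tens (v \<circ> Hilbert_Choice.inv \<sigma>)"
        by (rule Pe) (use True si in \<open>simp del: atLeastAtMost_iff\<close>)
      ultimately show ?thesis by (simp add: phi_tens[OF \<sigma> v] linear_rules(2)[OF P(1)])
    next
      case False
      then obtain i where i: "i \<in> {1..n}" "v i \<in> V1" using v by (auto simp: homogeneous_def)
      have "P (tens (v \<circ> Hilbert_Choice.inv \<sigma>)) = 0"
        by (rule Po[of "\<sigma> i"]) (use i si permutes_inverses[OF \<sigma>] in \<open>simp_all del: atLeastAtMost_iff\<close>)
      then show ?thesis
        using Po[of i v, OF i] by (simp add: phi_tens[OF \<sigma> v] linear_rules(2)[OF P(1)] linear_rules(3)[OF linear_phi[OF \<sigma>]])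
    qed
  qed
  then have "P \<in> carrier (commutant sT (\<phi> ` {\<sigma>. \<sigma> permutes {1..n}}))"
    using P(1) by (auto simp: carrier_commutant)
  then show ?thesis using that Pe Po by blast
qed

lemma alg_B_eq: "alg_B n V0 V1 sT tens = commutant sT (even_ops \<union> odd_ops)"
proof -
  have "\<phi> ` carrier (sym_group n) = even_ops \<union> odd_ops" by (auto simp: sym_group_carrier)
  then show ?thesis by (simp only: alg_B_def)
qed

lemma alg_A_eq: "alg_A n V0 V1 sT tens = commutant sT even_ops"
  by (simp add: alg_A_def alt_group_def)

lemma outer_odd_involution_exists:
  assumes dims: "vector_space.dim sV V0 = k" "vector_space.dim sV V1 = k" "k \<ge> 1" and n: "n \<ge> 2"
  obtains t u where "outer_odd_involution sT even_ops odd_ops t u"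
proof -
  obtain \<theta> where \<theta>: "Vector_Spaces.linear sV sV \<theta>"
    and \<theta>0: "\<And>x. x \<in> V0 \<Longrightarrow> \<theta> x \<in> V1 \<and> \<theta> (\<theta> x) = x"
    and \<theta>1: "\<And>x. x \<in> V1 \<Longrightarrow> \<theta> x \<in> V0 \<and> \<theta> (\<theta> x) = x"
    by (rule z2_graded_odd_involution[OF graded dims]) blast
  obtain u K where u: "Vector_Spaces.linear sT sT u" "\<And>x. u (u x) = x"
    and u_hom: "\<And>v. homogeneous v \<Longrightarrow> u (tens v) = sT (K v) (tens (\<theta> \<circ> v))"
    and comm: "\<And>\<sigma> x. \<sigma> permutes {1..n} \<Longrightarrow> u (\<phi> \<sigma> x) = sT (of_int (sign \<sigma>)) (\<phi> \<sigma> (u x))"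
    by (rule odd_operator[OF \<theta> \<theta>0 \<theta>1]) blast+
  \<comment> \<open>The assumption \<open>n \<ge> 2\<close> supplies an odd permutation that is an
    involution; its operator serves as \<open>t\<close>.\<close>
  define \<tau> where "\<tau> = transpose 1 (2 :: nat)"
  have \<tau>: "\<tau> permutes {1..n}" unfolding \<tau>_def using n by (intro permutes_swap_id) auto
  have odd\<tau>: "\<not> evenperm \<tau>" by (simp add: \<tau>_def evenperm_swap)
  have even_comp: "evenperm (\<sigma> \<circ> \<rho>) \<longleftrightarrow> evenperm \<sigma> = evenperm \<rho>"
    if "\<sigma> permutes {1..n}" "\<rho> permutes {1..n}" for \<sigma> \<rho>
    by (rule evenperm_comp) (use that in \<open>auto simp: permutation_permutes\<close>)
  have \<phi>\<tau>: "\<phi> \<tau> \<circ> \<phi> \<sigma> = \<phi> (\<tau> \<circ> \<sigma>)" "\<tau> \<circ> \<sigma> permutes {1..n}"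
    "\<phi> \<sigma> \<circ> \<phi> \<tau> = \<phi> (\<sigma> \<circ> \<tau>)" "\<sigma> \<circ> \<tau> permutes {1..n}" if "\<sigma> permutes {1..n}" for \<sigma>
    using phi_comp permutes_compose that \<tau> by blast+
  obtain P where P: "P \<in> carrier (commutant sT (\<phi> ` {\<sigma>. \<sigma> permutes {1..n}}))"
    and Pe: "\<And>v. (\<And>i. i \<in> {1..n} \<Longrightarrow> v i \<in> V0) \<Longrightarrow> P (tens v) = tens v"
    and Po: "\<And>v i. i \<in> {1..n} \<Longrightarrow> v i \<in> V1 \<Longrightarrow> P (tens v) = 0"
    by (rule even_projection) blast
  have "outer_odd_involution sT even_ops odd_ops (\<phi> \<tau>) u"
  proof (intro outer_odd_involution.intro odd_involution.intro outer_odd_involution_axioms.intro)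
    show "\<phi> \<tau> \<in> odd_ops" using \<tau> odd\<tau> by blast
    have "\<phi> \<tau> \<circ> \<phi> \<tau> = id" using \<phi>\<tau>(1)[OF \<tau>] phi_id by (simp add: \<tau>_def)
    then show "\<phi> \<tau> (\<phi> \<tau> x) = x" for x by (metis comp_apply id_apply)
    show "\<phi> \<tau> \<circ> g \<in> even_ops" "g \<circ> \<phi> \<tau> \<in> even_ops" if "g \<in> odd_ops" for g
      using that \<phi>\<tau> even_comp \<tau> odd\<tau> by auto
    show "\<phi> \<tau> \<circ> g \<in> odd_ops" "g \<circ> \<phi> \<tau> \<in> odd_ops" if "g \<in> even_ops" for g
      using that \<phi>\<tau> even_comp \<tau> odd\<tau> by auto
    show "Vector_Spaces.linear sT sT g" if "g \<in> even_ops \<union> odd_ops" for g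
      using that linear_phi by blast
    show "u (g x) = g (u x)" if "g \<in> even_ops" for g x
      using that comm by (auto simp: sign_def)
    show "u (g x) = - g (u x)" if "g \<in> odd_ops" for g x
      using that comm by (auto simp: sign_def)
    \<comment> \<open>Since \<open>k \<ge> 1\<close>, there is a nonzero \<open>a\<close> in
      \<open>V0\<close>. \<open>P\<close> fixes the tensor with all factors \<open>a\<close>, while
      \<open>u\<close> sends it to a multiple of the tensor with all factors
      \<open>\<theta> a\<close>, which \<open>P\<close> kills. Hence \<open>u\<close> and
      \<open>P\<close> do not commute.\<close>
    have "\<not> V0 \<subseteq> V.span {}"
    proof
      assume "V0 \<subseteq> V.span {}"
      then have "V.dim V0 \<le> card ({} :: 'v set)" by (intro V.dim_le_card) auto
      then show False using dims by simp
    qed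
    then obtain a where a: "a \<in> V0" "a \<noteq> 0" by auto
    let ?v = "\<lambda>_ :: nat. a"
    have one: "1 \<in> {1..n}" using n by simp
    have "P (u (tens ?v)) = sT (K ?v) (P (tens (\<theta> \<circ> ?v)))"
      using u_hom[of ?v] a linear_rules(2)[of sT sT P] P by (simp add: homogeneous_def carrier_commutant)
    also have "P (tens (\<theta> \<circ> ?v)) = 0"
      by (rule Po[OF one]) (use \<theta>0[OF a(1)] in simp)
    finally have "P (u (tens ?v)) = 0" by simp
    moreover have "u (P (tens ?v)) = u (tens ?v)" using Pe[of ?v] a by simp
    moreover have "u (tens ?v) \<noteq> 0"
      using tens_nonzero[of ?v] a u(2)[of "tens ?v"] linear_rules(3)[OF u(1)] by auto
    ultimately have "u \<circ> P \<noteq> P \<circ> u" by (metis comp_apply)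
    moreover have "P \<in> carrier (commutant sT (even_ops \<union> odd_ops))"
      using P by (auto simp: carrier_commutant)
    ultimately show "\<exists>f\<in>carrier (commutant sT (even_ops \<union> odd_ops)). u \<circ> f \<noteq> f \<circ> u" by blast
  qed (use u T.vector_space_axioms in auto)
  then show ?thesis by (rule that)
qed

end

theorem theorem1p1:
  fixes sV :: "complex \<Rightarrow> 'v::ab_group_add \<Rightarrow> 'v"
    and V0 V1 :: "'v set"
    and sT :: "complex \<Rightarrow> 't::ab_group_add \<Rightarrow> 't"
    and tens :: "(nat \<Rightarrow> 'v) \<Rightarrow> 't"
    and n k :: nat
  assumes "z2_graded sV V0 V1"
    and "vector_space.dim sV V0 = k"
    and "vector_space.dim sV V1 = k"
    and "k \<ge> 1"
    and "n \<ge> 2"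
    and "tensor_power n sV sT tens"
  shows "(\<exists>H. subgroup H (alg_aut_group (alg_B n V0 V1 sT tens)) \<and>
            (alg_aut_group (alg_B n V0 V1 sT tens))\<lparr>carrier := H\<rparr> \<cong> integer_mod_group 2 \<and>
            alg_iso (alg_A n V0 V1 sT tens)
              (crossed_product (alg_B n V0 V1 sT tens)
                ((alg_aut_group (alg_B n V0 V1 sT tens))\<lparr>carrier := H\<rparr>)) \<noteq> {}) \<and>
         alg_dim (alg_A n V0 V1 sT tens) = 2 * alg_dim (alg_B n V0 V1 sT tens)"
proof -
  interpret graded_tensor_power sV V0 V1 sT tens n
    using assms by unfold_locales
  obtain t u where "outer_odd_involution sT even_ops odd_ops t u"
    by (rule outer_odd_involution_exists[OF assms(2-5)])
  then show ?thesis
    unfolding alg_A_eq alg_B_eq by (rule outer_odd_involution.crossed_product_decomposition)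
qed

end
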